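(* Let $\Phi : \mathscr{S} \ni s \mapsto T_s \in \mathscr{L}(X)$ be a homomorphism of a strongly [resp. weakly] right amenable SGT $\mathscr{S}$ into $\mathscr{L}(X)$, where $X$ is a Banach space. Suppose $Y$ is a finite-dimensional linear subspace of $X$ such that: (fp0) $\Phi$ is continuous in the weak operator topology [resp. strong operator topology] of $\mathscr{L}(X)$; (fp1) for any $s \in \mathscr{S}$, $T_s(Y) = Y$; (p4') the quantity $m_Y(\Phi) = \sup_{s\in\mathscr{S}} (\|T_s\| \cdot \|(T_s|_Y)^{-1}\|)$ is finite. Then there exists a $\Phi$-minimal projection $P : X \to Y$, and $\|P\| \leqslant m_Y(\Phi)\, \lambda(X,Y)$. (The statement consists of two versions: "strongly / weak operator topology" and "weakly / strong operator topology".)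
   Context: An SGT (semigroup with topology) is a non-empty semigroup $\mathscr{S}$ that is also a (possibly non-Hausdorff) topological space; no compatibility between the multiplication and the topology is assumed. For $f:\mathscr{S}\to\mathbb{R}$ and $s\in\mathscr{S}$ let $f_s(t)=f(ts)$. $C_b(\mathscr{S})$ is the space of bounded continuous real-valued functions on $\mathscr{S}$ with the sup-norm, and $C_r(\mathscr{S})=\{f\in C_b(\mathscr{S}): f_s \text{ is continuous for every } s\in\mathscr{S}\}$. Let $C_{norm}(\mathscr{S})$ [resp. $C_{weak}(\mathscr{S})$] be the set of all $f\in C_r(\mathscr{S})$ such that $s\mapsto f_s$ and, for all $t\in\mathscr{S}$, $s\mapsto f_{st}$ are continuous from $\mathscr{S}$ to $C_r(\mathscr{S})$ equipped with its norm [resp. weak] topology. A mean on a linear subspace $\mathscr{F}$ of $C_r(\mathscr{S})$ is a linear functional $\phi:\mathscr{F}\to\mathbb{R}$ with $\inf f(\mathscr{S})\leqslant\phi(f)\leqslant\sup f(\mathscr{S})$ for all $f\in\mathscr{F}$; if $\mathscr{F}$ is right invariant ($f_s\in\mathscr{F}$ for $f\in\mathscr{F}$, $s\in\mathscr{S}$), the mean is right invariant if $\phi(f_s)=\phi(f)$ for all $f\in\mathscr{F}$, $s\in\mathscr{S}$. $\mathscr{S}$ is weakly [resp. strongly] right amenable if there is a right invariant mean on $C_{norm}(\mathscr{S})$ [resp. $C_{weak}(\mathscr{S})$]. Banach spaces are real or complex. $\mathscr{L}(X)$ is the algebra of bounded linear operators on $X$; $s\mapsto T_s$ is a homomorphism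 if $T_{st}=T_sT_t$ for all $s,t$. A projection $P:X\to Y$ is a bounded linear operator with $Py=y$ for all $y\in Y$, and $\lambda(X,Y)=\inf\{\|P\|: P:X\to Y \text{ a projection}\}$. A projection $P_0:X\to Y$ is $\Phi$-minimal if $P_0$ commutes with all $T_s$ and $\|P_0\|\leqslant\|P\|$ for any other projection $P:X\to Y$ that commutes with all $T_s$. *)

theory Defs
  imports "HOL-Analysis.Analysis"
begin

text \<open>
  An SGT is a type of class \<open>{semigroup_mult, topological_space}\<close>: types are non-empty, the topology
  need not be Hausdorff, and the two classes share no axiom.
\<close>

section \<open>Function spaces on an SGT\<close>

definition C_r :: "('s::{semigroup_mult, topological_space} \<Rightarrow>\<^sub>C real) set" where
  "C_r = {f. \<forall>s. continuous_on UNIV (\<lambda>t. apply_bcontfun f (t * s))}"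

text \<open>The translate \<open>f\<^sub>s\<close>. It is meaningful only for \<open>f \<in> C_r\<close>: otherwise \<open>Bcontfun\<close> may be applied to
  a discontinuous function.\<close>

definition rtrans ::
    "('s::{semigroup_mult, topological_space} \<Rightarrow>\<^sub>C real) \<Rightarrow> 's \<Rightarrow> ('s \<Rightarrow>\<^sub>C real)" where
  "rtrans f s = Bcontfun (\<lambda>t. apply_bcontfun f (t * s))"

definition linear_functional_on :: "'v::real_vector set \<Rightarrow> ('v \<Rightarrow> real) \<Rightarrow> bool" where
  "linear_functional_on V \<psi> \<longleftrightarrow>
     (\<forall>x\<in>V. \<forall>y\<in>V. \<psi> (x + y) = \<psi> x + \<psi> y) \<and> (\<forall>c. \<forall>x\<in>V. \<psi> (c *\<^sub>R x) = c * \<psi> x)"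

text \<open>Continuous dual and weak topology of a linear subspace \<open>V\<close> regarded as a normed space in its own
  right; values of \<open>\<psi>\<close> outside \<open>V\<close> are irrelevant.\<close>

definition dual_on :: "'v::real_normed_vector set \<Rightarrow> ('v \<Rightarrow> real) set" where
  "dual_on V = {\<psi>. linear_functional_on V \<psi> \<and> (\<exists>B. \<forall>x\<in>V. \<bar>\<psi> x\<bar> \<le> B * norm x)}"

definition weak_topology_on :: "'v::real_normed_vector set \<Rightarrow> 'v topology" where
  "weak_topology_on V =
     topology_generated_by {{x \<in> V. \<psi> x \<in> U} | \<psi> U. \<psi> \<in> dual_on V \<and> open U}"

definition C_norm :: "('s::{semigroup_mult, topological_space} \<Rightarrow>\<^sub>C real) set" where
  "C_norm = {f \<in> C_r. continuous_on UNIV (\<lambda>s. rtrans f s) \<and>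
                      (\<forall>t. continuous_on UNIV (\<lambda>s. rtrans f (s * t)))}"

definition C_weak :: "('s::{semigroup_mult, topological_space} \<Rightarrow>\<^sub>C real) set" where
  "C_weak = {f \<in> C_r. continuous_map euclidean (weak_topology_on C_r) (\<lambda>s. rtrans f s) \<and>
                      (\<forall>t. continuous_map euclidean (weak_topology_on C_r) (\<lambda>s. rtrans f (s * t)))}"

section \<open>Means and right amenability\<close>

definition is_mean ::
    "('s::{semigroup_mult, topological_space} \<Rightarrow>\<^sub>C real) set \<Rightarrow> (('s \<Rightarrow>\<^sub>C real) \<Rightarrow> real) \<Rightarrow> bool" where
  "is_mean F \<phi> \<longleftrightarrow> linear_functional_on F \<phi> \<and>
     (\<forall>f\<in>F. (INF s. apply_bcontfun f s) \<le> \<phi> f \<and> \<phi> f \<le> (SUP s. apply_bcontfun f s))"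

definition right_invariant_mean ::
    "('s::{semigroup_mult, topological_space} \<Rightarrow>\<^sub>C real) set \<Rightarrow> (('s \<Rightarrow>\<^sub>C real) \<Rightarrow> real) \<Rightarrow> bool" where
  "right_invariant_mean F \<phi> \<longleftrightarrow> is_mean F \<phi> \<and> (\<forall>f\<in>F. \<forall>s. \<phi> (rtrans f s) = \<phi> f)"

definition weakly_right_amenable :: "'s::{semigroup_mult, topological_space} itself \<Rightarrow> bool" where
  "weakly_right_amenable _ \<longleftrightarrow> (\<exists>\<phi>. right_invariant_mean (C_norm :: ('s \<Rightarrow>\<^sub>C real) set) \<phi>)"

definition strongly_right_amenable :: "'s::{semigroup_mult, topological_space} itself \<Rightarrow> bool" where
  "strongly_right_amenable _ \<longleftrightarrow> (\<exists>\<phi>. right_invariant_mean (C_weak :: ('s \<Rightarrow>\<^sub>C real) set) \<phi>)"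

text \<open>\<open>C_norm\<close> and \<open>C_weak\<close> are right invariant linear subspaces of \<open>C_r\<close>, so the notions above apply
  to them.\<close>

lemma apply_rtrans:
  assumes "f \<in> C_r"
  shows "apply_bcontfun (rtrans f s) t = apply_bcontfun f (t * s)"
proof -
  have "bounded (range (\<lambda>t. apply_bcontfun f (t * s)))"
    by (rule bounded_subset[OF bounded_apply_bcontfun[of f]]) auto
  then have "(\<lambda>t. apply_bcontfun f (t * s)) \<in> bcontfun"
    using assms by (auto simp: C_r_def bcontfun_def)
  then show ?thesis
    by (simp add: rtrans_def Bcontfun_inverse)
qed

lemma rtrans_in_C_r: "f \<in> C_r \<Longrightarrow> rtrans f s \<in> C_r"
  by (simp add: C_r_def apply_rtrans[unfolded C_r_def] mult.assoc)

lemma rtrans_rtrans: "f \<in> C_r \<Longrightarrow> rtrans (rtrans f u) s = rtrans f (s * u)"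
  by (rule bcontfun_eqI) (simp add: apply_rtrans rtrans_in_C_r mult.assoc)

lemma rtrans_in_C_norm: "f \<in> C_norm \<Longrightarrow> rtrans f u \<in> C_norm"
  by (simp add: C_norm_def rtrans_in_C_r rtrans_rtrans mult.assoc)

lemma rtrans_in_C_weak:
  assumes "f \<in> C_weak"
  shows "rtrans f u \<in> C_weak"
proof -
  have "rtrans (rtrans f u) = (\<lambda>s. rtrans f (s * u))"
    using assms by (simp add: C_weak_def rtrans_rtrans fun_eq_iff)
  then show ?thesis
    using assms by (simp add: C_weak_def rtrans_in_C_r mult.assoc)
qed

lemma subspace_C_r: "subspace C_r"
  by (auto simp: subspace_def C_r_def intro!: continuous_intros)

lemma rtrans_add: "f \<in> C_r \<Longrightarrow> g \<in> C_r \<Longrightarrow> rtrans (f + g) s = rtrans f s + rtrans g s"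
  by (rule bcontfun_eqI) (simp add: apply_rtrans subspace_add[OF subspace_C_r])

lemma rtrans_scaleR: "f \<in> C_r \<Longrightarrow> rtrans (c *\<^sub>R f) s = c *\<^sub>R rtrans f s"
  by (rule bcontfun_eqI) (simp add: apply_rtrans subspace_scale[OF subspace_C_r])

lemma rtrans_0: "rtrans 0 s = 0"
  by (rule bcontfun_eqI) (simp add: apply_rtrans subspace_0[OF subspace_C_r])

lemma subspace_C_norm: "subspace C_norm"
  unfolding subspace_def C_norm_def
  by (simp add: subspace_0[OF subspace_C_r] subspace_add[OF subspace_C_r]
      subspace_scale[OF subspace_C_r] rtrans_add rtrans_scaleR rtrans_0
      continuous_on_add continuous_on_scaleR)

lemma zero_in_dual_on: "(\<lambda>_. 0) \<in> dual_on V"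
  unfolding dual_on_def
proof (intro CollectI conjI exI ballI)
  show "linear_functional_on V (\<lambda>_. 0)"
    by (simp add: linear_functional_on_def)
  show "\<bar>0\<bar> \<le> 0 * norm x" for x :: 'a
    by simp
qed

lemma topspace_weak_topology_on: "topspace (weak_topology_on V) = V"
  unfolding weak_topology_on_def topology_generated_by_topspace
proof (intro equalityI Union_upper Union_least)
  show "V \<in> {{x \<in> V. \<psi> x \<in> U} | \<psi> U. \<psi> \<in> dual_on V \<and> open U}"
    by (intro CollectI exI[of _ "\<lambda>_. 0"] exI[of _ UNIV] conjI zero_in_dual_on open_UNIV) simp
next
  fix W assume "W \<in> {{x \<in> V. \<psi> x \<in> U} | \<psi> U. \<psi> \<in> dual_on V \<and> open U}"
  then show "W \<subseteq> V"
    by (elim CollectE exE conjE) simp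
qed

lemma continuous_map_weak_topology_on:
  "continuous_map X (weak_topology_on V) f \<longleftrightarrow>
     f \<in> topspace X \<rightarrow> V \<and> (\<forall>\<psi>\<in>dual_on V. continuous_map X euclidean (\<lambda>x. \<psi> (f x)))"
proof -
  have un: "\<Union>{{x \<in> V. \<psi> x \<in> U} | \<psi> U. \<psi> \<in> dual_on V \<and> open U} = V"
    using topspace_weak_topology_on[of V]
    unfolding weak_topology_on_def topology_generated_by_topspace .
  have vim: "f -` {x \<in> V. \<psi> x \<in> U} \<inter> topspace X = {x \<in> topspace X. \<psi> (f x) \<in> U}"
    if "f ` topspace X \<subseteq> V" for \<psi> :: "'b \<Rightarrow> real" and U
    using that by auto
  have "continuous_map X (weak_topology_on V) f \<longleftrightarrow>
     f ` topspace X \<subseteq> V \<and>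
     (\<forall>\<psi>\<in>dual_on V. \<forall>U. open U \<longrightarrow> openin X (f -` {x \<in> V. \<psi> x \<in> U} \<inter> topspace X))"
    unfolding weak_topology_on_def continuous_on_generated_topo_iff un by blast
  also have "\<dots> \<longleftrightarrow> f ` topspace X \<subseteq> V \<and>
     (\<forall>\<psi>\<in>dual_on V. \<forall>U. open U \<longrightarrow> openin X {x \<in> topspace X. \<psi> (f x) \<in> U})"
    by (rule conj_cong) (simp_all only: vim)
  also have "\<dots> \<longleftrightarrow> f \<in> topspace X \<rightarrow> V \<and>
     (\<forall>\<psi>\<in>dual_on V. continuous_map X euclidean (\<lambda>x. \<psi> (f x)))"
    by (simp only: continuous_map_def image_subset_iff_funcset topspace_euclidean open_openin
        Pi_UNIV UNIV_I simp_thms)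
  finally show ?thesis .
qed

lemma weak_continuous_C_r:
  "continuous_map euclidean (weak_topology_on C_r) F \<longleftrightarrow>
     (\<forall>s. F s \<in> C_r) \<and> (\<forall>\<psi>\<in>dual_on C_r. continuous_on UNIV (\<lambda>s. \<psi> (F s)))"
  by (simp add: continuous_map_weak_topology_on Pi_iff)

lemma weak_continuous_add:
  fixes F G :: "'t::topological_space \<Rightarrow> ('s::{semigroup_mult, topological_space} \<Rightarrow>\<^sub>C real)"
  assumes "continuous_map euclidean (weak_topology_on C_r) F"
    and "continuous_map euclidean (weak_topology_on C_r) G"
  shows "continuous_map euclidean (weak_topology_on C_r) (\<lambda>s. F s + G s)"
  unfolding weak_continuous_C_r
proof (intro conjI allI ballI)
  show "F s + G s \<in> C_r" for s
    using assms by (simp add: weak_continuous_C_r subspace_add[OF subspace_C_r])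
  fix \<psi> :: "('s \<Rightarrow>\<^sub>C real) \<Rightarrow> real" assume \<psi>: "\<psi> \<in> dual_on C_r"
  have "\<psi> (F s + G s) = \<psi> (F s) + \<psi> (G s)" for s
    using assms \<psi> unfolding weak_continuous_C_r dual_on_def linear_functional_on_def by blast
  then show "continuous_on UNIV (\<lambda>s. \<psi> (F s + G s))"
    using assms \<psi> by (simp add: weak_continuous_C_r continuous_on_add)
qed

lemma weak_continuous_scaleR:
  fixes F :: "'t::topological_space \<Rightarrow> ('s::{semigroup_mult, topological_space} \<Rightarrow>\<^sub>C real)"
  assumes "continuous_map euclidean (weak_topology_on C_r) F"
  shows "continuous_map euclidean (weak_topology_on C_r) (\<lambda>s. c *\<^sub>R F s)"
  unfolding weak_continuous_C_r
proof (intro conjI allI ballI)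
  show "c *\<^sub>R F s \<in> C_r" for s
    using assms by (simp add: weak_continuous_C_r subspace_scale[OF subspace_C_r])
  fix \<psi> :: "('s \<Rightarrow>\<^sub>C real) \<Rightarrow> real" assume \<psi>: "\<psi> \<in> dual_on C_r"
  have "\<psi> (c *\<^sub>R F s) = c * \<psi> (F s)" for s
    using assms \<psi> unfolding weak_continuous_C_r dual_on_def linear_functional_on_def by blast
  then show "continuous_on UNIV (\<lambda>s. \<psi> (c *\<^sub>R F s))"
    using assms \<psi> by (simp add: weak_continuous_C_r continuous_on_mult_left)
qed

lemma subspace_C_weak: "subspace C_weak"
proof (rule subspaceI)
  show "0 \<in> C_weak"
    by (simp add: C_weak_def weak_continuous_C_r subspace_0[OF subspace_C_r] rtrans_0)
next
  fix f g :: "'a \<Rightarrow>\<^sub>C real" assume "f \<in> C_weak" "g \<in> C_weak"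
  moreover from this have "rtrans (f + g) = (\<lambda>s. rtrans f s + rtrans g s)"
    by (simp add: C_weak_def rtrans_add fun_eq_iff)
  ultimately show "f + g \<in> C_weak"
    by (simp add: C_weak_def subspace_add[OF subspace_C_r] weak_continuous_add)
next
  fix c and f :: "'a \<Rightarrow>\<^sub>C real" assume "f \<in> C_weak"
  moreover from this have "rtrans (c *\<^sub>R f) = (\<lambda>s. c *\<^sub>R rtrans f s)"
    by (simp add: C_weak_def rtrans_scaleR fun_eq_iff)
  ultimately show "c *\<^sub>R f \<in> C_weak"
    by (simp add: C_weak_def subspace_scale[OF subspace_C_r] weak_continuous_scaleR)
qed

section \<open>Real and complex Banach spaces\<close>

text \<open>
  The scalars form a type \<open>'k\<close> of class \<open>{real_normed_field, euclidean_space}\<close>, i.e. a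
  finite-dimensional field extension of the reals with a multiplicative norm. Both \<^typ>\<open>real\<close> and
  \<^typ>\<open>complex\<close> belong to it, and every member is isometrically isomorphic to one of these two. So a
  statement about all such \<open>'k\<close> is a statement about real and about complex Banach spaces.

  The class \<open>banach\<close> only provides the underlying real Banach space; \<open>sc\<close> is the scalar
  multiplication, which for real scalars is just \<open>scaleR\<close>.
\<close>

locale banach_space_over = vector_space sc
  for sc :: "'k::{real_normed_field, euclidean_space} \<Rightarrow> 'x::banach \<Rightarrow> 'x" +
  assumes norm_scale: "norm (sc c x) = norm c * norm x"
    and scale_of_real: "sc (of_real r) x = r *\<^sub>R x"

lemma banach_space_over_real: "banach_space_over sc \<longleftrightarrow> sc = scaleR"
  for sc :: "real \<Rightarrow> 'x::banach \<Rightarrow> 'x"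
proof
  assume "banach_space_over sc"
  then interpret banach_space_over sc .
  show "sc = scaleR"
    using scale_of_real by (simp add: fun_eq_iff)
next
  assume "sc = scaleR"
  then show "banach_space_over sc"
    by unfold_locales (simp_all add: algebra_simps)
qed

definition bounded_operators ::
    "('k::{real_normed_field, euclidean_space} \<Rightarrow> 'x::banach \<Rightarrow> 'x) \<Rightarrow> ('x \<Rightarrow>\<^sub>L 'x) set" where
  "bounded_operators sc =
     {T. \<forall>c x. blinfun_apply T (sc c x) = sc c (blinfun_apply T x)}"

definition dual_space ::
    "('k::{real_normed_field, euclidean_space} \<Rightarrow> 'x::banach \<Rightarrow> 'x) \<Rightarrow> ('x \<Rightarrow>\<^sub>L 'k) set" where
  "dual_space sc =
     {f. \<forall>c x. blinfun_apply f (sc c x) = c * blinfun_apply f x}"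

definition WOT ::
    "('k::{real_normed_field, euclidean_space} \<Rightarrow> 'x::banach \<Rightarrow> 'x) \<Rightarrow> ('x \<Rightarrow>\<^sub>L 'x) topology" where
  "WOT sc = topology_generated_by
     {{T \<in> bounded_operators sc. blinfun_apply f (blinfun_apply T x) \<in> U} | f x U.
        f \<in> dual_space sc \<and> open U}"

definition SOT ::
    "('k::{real_normed_field, euclidean_space} \<Rightarrow> 'x::banach \<Rightarrow> 'x) \<Rightarrow> ('x \<Rightarrow>\<^sub>L 'x) topology" where
  "SOT sc = subtopology strong_operator_topology (bounded_operators sc)"

definition finite_dim_subspace ::
    "('k::{real_normed_field, euclidean_space} \<Rightarrow> 'x::banach \<Rightarrow> 'x) \<Rightarrow> 'x set \<Rightarrow> bool" where
  "finite_dim_subspace sc Y \<longleftrightarrow> (\<exists>B. finite B \<and> Y = module.span sc B)"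

section \<open>Projections\<close>

definition projections ::
    "('k::{real_normed_field, euclidean_space} \<Rightarrow> 'x::banach \<Rightarrow> 'x) \<Rightarrow> 'x set \<Rightarrow> ('x \<Rightarrow>\<^sub>L 'x) set" where
  "projections sc Y =
     {P \<in> bounded_operators sc. range (blinfun_apply P) \<subseteq> Y \<and> (\<forall>y\<in>Y. blinfun_apply P y = y)}"

definition projection_constant ::
    "('k::{real_normed_field, euclidean_space} \<Rightarrow> 'x::banach \<Rightarrow> 'x) \<Rightarrow> 'x set \<Rightarrow> real" where
  "projection_constant sc Y = (INF P\<in>projections sc Y. norm P)"

definition commutes_with :: "('x::banach \<Rightarrow>\<^sub>L 'x) \<Rightarrow> ('s \<Rightarrow> ('x \<Rightarrow>\<^sub>L 'x)) \<Rightarrow> bool" where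
  "commutes_with P T \<longleftrightarrow> (\<forall>s. P o\<^sub>L T s = T s o\<^sub>L P)"

definition minimal_projection ::
    "('k::{real_normed_field, euclidean_space} \<Rightarrow> 'x::banach \<Rightarrow> 'x) \<Rightarrow> 'x set \<Rightarrow>
     ('s \<Rightarrow> ('x \<Rightarrow>\<^sub>L 'x)) \<Rightarrow> ('x \<Rightarrow>\<^sub>L 'x) \<Rightarrow> bool" where
  "minimal_projection sc Y T P0 \<longleftrightarrow>
     P0 \<in> projections sc Y \<and> commutes_with P0 T \<and>
     (\<forall>P\<in>projections sc Y. commutes_with P T \<longrightarrow> norm P0 \<le> norm P)"

section \<open>The quantity \<open>m\<^sub>Y(\<Phi>)\<close>\<close>

text \<open>Operator norm of \<open>g : Y \<rightarrow> X\<close>, defined as \<^const>\<open>onorm\<close> but with the supremum over \<open>Y\<close> only.\<close>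

definition onorm_on :: "'x::real_normed_vector set \<Rightarrow> ('x \<Rightarrow> 'x) \<Rightarrow> real" where
  "onorm_on Y g = (SUP y\<in>Y. norm (g y) / norm y)"

text \<open>If \<open>Y\<close> is finite-dimensional and \<open>T s ` Y = Y\<close>, then \<open>T s\<close> is injective on \<open>Y\<close> and
  \<open>inv_into Y (T s)\<close> is the inverse of the restriction of \<open>T s\<close> to \<open>Y\<close>.\<close>

definition m_term :: "'x::banach set \<Rightarrow> ('s \<Rightarrow> ('x \<Rightarrow>\<^sub>L 'x)) \<Rightarrow> 's \<Rightarrow> real" where
  "m_term Y T s = norm (T s) * onorm_on Y (inv_into Y (blinfun_apply (T s)))"

definition m_const :: "'x::banach set \<Rightarrow> ('s \<Rightarrow> ('x \<Rightarrow>\<^sub>L 'x)) \<Rightarrow> real" where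
  "m_const Y T = (SUP s. m_term Y T s)"

end

theory Submission
  imports Defs
begin

text \<open>Let \<open>P\<close> be any bounded projection onto \<open>Y\<close>. Each conjugate \<open>(T\<^sub>s|\<^sub>Y)\<inverse> P T\<^sub>s\<close> is again a projection onto \<open>Y\<close>,
  of norm at most \<open>m\<^sub>Y(\<Phi>) \<parallel>P\<parallel>\<close>, and replacing \<open>s\<close> by \<open>su\<close> conjugates it once more by \<open>T\<^sub>u\<close>. Averaging
  the conjugates over \<open>s\<close> with a right invariant mean therefore gives a projection that commutes with
  every \<open>T\<^sub>u\<close> and obeys the same norm bound (\<open>ex_equivariant_projection\<close>). The average \<open>Q x\<close> is
  determined by its values under real functionals \<open>\<xi>\<close>: \<open>\<xi> (Q x)\<close> is the mean of the orbit function
  \<open>s \<mapsto> \<xi> ((T\<^sub>s|\<^sub>Y)\<inverse> P T\<^sub>s x)\<close>.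

  The mean is only defined on \<open>C_norm\<close> or \<open>C_weak\<close>, so orbit functions have to lie there. The key is
  that the translate by \<open>u\<close> of an orbit function is the orbit function of a pulled back functional
  and of the vector \<open>T\<^sub>u x\<close> (\<open>rtrans_orbit_fun\<close>). Orbit functions are bounded and bilinear in
  functional and vector. The pulled back functional varies continuously in norm, because \<open>Y\<close> is
  finite-dimensional and \<open>u \<mapsto> (T\<^sub>u|\<^sub>Y)\<inverse>\<close> is continuous; the latter follows from the finiteness of
  \<open>m\<^sub>Y(\<Phi>)\<close> (\<open>continuous_R\<close>). Hence translation is norm continuous when \<open>u \<mapsto> T\<^sub>u x\<close> is, and weakly
  continuous when \<open>u \<mapsto> T\<^sub>u x\<close> is weakly continuous.

  Commuting projections thus exist, and by compactness of pointwise bounded sets of maps into \<open>Y\<close> one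
  of them has least norm (\<open>ex_minimal_projection\<close>). Comparing it with the averages of all projections
  \<open>P\<close> gives the bound by \<open>m\<^sub>Y(\<Phi>) \<lambda>(X,Y)\<close>.

  Functionals and projections come from the Hahn-Banach theorem, proved for real functionals and
  carried over to the scalar field by \<open>ex_dual_of_real_functional\<close>.\<close>

section \<open>The Hahn-Banach theorem for real functionals\<close>

text \<open>Inequality suffices in the homogeneity clause: applied to \<open>c\<close> and to \<open>1 / c\<close> it gives equality.\<close>

definition sublinear :: "('a::real_vector \<Rightarrow> real) \<Rightarrow> bool" where
  "sublinear p \<longleftrightarrow> (\<forall>x y. p (x + y) \<le> p x + p y) \<and> (\<forall>c\<ge>0. \<forall>x. p (c *\<^sub>R x) \<le> c * p x)"

lemma sublinear_add: "sublinear p \<Longrightarrow> p (x + y) \<le> p x + p y"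
  by (simp add: sublinear_def)

lemma sublinear_scale: "sublinear p \<Longrightarrow> 0 \<le> c \<Longrightarrow> p (c *\<^sub>R x) = c * p x"
proof -
  assume p: "sublinear p" and "0 \<le> c"
  have 0: "p 0 = 0"
  proof (rule antisym)
    show "p 0 \<le> 0"
      using p unfolding sublinear_def by (metis mult_zero_left order_refl scaleR_zero_left)
    show "0 \<le> p 0"
      using sublinear_add[OF p, of 0 0] by simp
  qed
  show ?thesis
  proof (cases "c = 0")
    case False
    then have c: "c > 0" using \<open>0 \<le> c\<close> by simp
    have le: "p (d *\<^sub>R y) \<le> d * p y" if "d \<ge> 0" for d y
      using p that by (simp add: sublinear_def)
    have "p x \<le> inverse c * p (c *\<^sub>R x)"
      using le[of "inverse c" "c *\<^sub>R x"] c by simp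
    then have "c * p x \<le> p (c *\<^sub>R x)"
      using c by (simp add: field_simps)
    with le[of c x] c show ?thesis by simp
  qed (simp add: 0)
qed

lemma sublinear_0: "sublinear p \<Longrightarrow> p 0 = 0"
  using sublinear_scale[of p 0 0] by simp

lemma sublinear_minus: "sublinear p \<Longrightarrow> - p (- x) \<le> p x"
  using sublinear_add[of p x "- x"] sublinear_0[of p] by simp

text \<open>The largest sublinear function below \<open>p\<close> with value \<open>- p b\<close> at \<open>- b\<close>: it is \<open>p\<close> made linear along the ray
  spanned by \<open>b\<close>.\<close>

definition tilt :: "('a::real_vector \<Rightarrow> real) \<Rightarrow> 'a \<Rightarrow> 'a \<Rightarrow> real" where
  "tilt p b x = (INF t\<in>{0..}. p (x + t *\<^sub>R b) - t * p b)"

lemma tilt_lower: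
  assumes p: "sublinear p" and "0 \<le> t"
  shows "- p (- x) \<le> p (x + t *\<^sub>R b) - t * p b"
  using sublinear_add[OF p, of "x + t *\<^sub>R b" "- x"] sublinear_scale[OF p \<open>0 \<le> t\<close>, of b] by simp

lemma tilt_le:
  assumes p: "sublinear p" and "0 \<le> t"
  shows "tilt p b x \<le> p (x + t *\<^sub>R b) - t * p b"
  unfolding tilt_def
proof (rule cINF_lower)
  show "bdd_below ((\<lambda>t. p (x + t *\<^sub>R b) - t * p b) ` {0..})"
    using tilt_lower[OF p] by (auto intro!: bdd_belowI[where m = "- p (- x)"])
qed (use assms in auto)

lemma tilt_greatest:
  assumes "\<And>t. 0 \<le> t \<Longrightarrow> m \<le> p (x + t *\<^sub>R b) - t * p b"
  shows "m \<le> tilt p b x"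
  unfolding tilt_def using assms by (intro cINF_greatest) auto

lemma sublinear_tilt:
  assumes p: "sublinear p"
  shows "sublinear (tilt p b)"
  unfolding sublinear_def
proof (intro conjI allI impI)
  fix x y
  have *: "tilt p b (x + y) \<le> (p (x + t *\<^sub>R b) - t * p b) + (p (y + u *\<^sub>R b) - u * p b)"
    if "0 \<le> t" "0 \<le> u" for t u
  proof -
    have "tilt p b (x + y) \<le> p ((x + y) + (t + u) *\<^sub>R b) - (t + u) * p b"
      using that by (intro tilt_le[OF p]) simp
    also have "(x + y) + (t + u) *\<^sub>R b = (x + t *\<^sub>R b) + (y + u *\<^sub>R b)"
      by (simp add: algebra_simps)
    finally show ?thesis
      using sublinear_add[OF p, of "x + t *\<^sub>R b" "y + u *\<^sub>R b"] by (simp add: algebra_simps)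
  qed
  have "tilt p b (x + y) - (p (x + t *\<^sub>R b) - t * p b) \<le> tilt p b y" if "0 \<le> t" for t
    using *[OF that] by (intro tilt_greatest) (simp add: algebra_simps)
  then have "tilt p b (x + y) - tilt p b y \<le> tilt p b x"
    by (intro tilt_greatest) (simp add: algebra_simps)
  then show "tilt p b (x + y) \<le> tilt p b x + tilt p b y"
    by simp
next
  fix c :: real and x assume "0 \<le> c"
  show "tilt p b (c *\<^sub>R x) \<le> c * tilt p b x"
  proof (cases "c = 0")
    case True
    then show ?thesis
      using tilt_le[OF p, of 0 b 0] sublinear_0[OF p] by simp
  next
    case False
    have "tilt p b (c *\<^sub>R x) / c \<le> p (x + t *\<^sub>R b) - t * p b" if "0 \<le> t" for t
    proof -
      have "tilt p b (c *\<^sub>R x) \<le> p (c *\<^sub>R x + (c * t) *\<^sub>R b) - (c * t) * p b"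
        using that \<open>0 \<le> c\<close> by (intro tilt_le[OF p]) simp
      also have "c *\<^sub>R x + (c * t) *\<^sub>R b = c *\<^sub>R (x + t *\<^sub>R b)"
        by (simp add: algebra_simps)
      finally show ?thesis
        using \<open>0 \<le> c\<close> False sublinear_scale[OF p \<open>0 \<le> c\<close>, of "x + t *\<^sub>R b"]
        by (simp add: field_simps)
    qed
    then have "tilt p b (c *\<^sub>R x) / c \<le> tilt p b x"
      by (rule tilt_greatest)
    then show ?thesis
      using \<open>0 \<le> c\<close> False by (simp add: field_simps)
  qed
qed

text \<open>Zorn's lemma: the pointwise infimum of a chain of sublinear functions below \<open>p\<close> is again sublinear,
  and it is finite since each of them is at least \<open>- p (- x)\<close> at \<open>x\<close>.\<close>

lemma ex_minimal_sublinear: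
  fixes p :: "'a::real_vector \<Rightarrow> real"
  assumes p: "sublinear p"
  shows "\<exists>q. sublinear q \<and> q \<le> p \<and> (\<forall>r. sublinear r \<longrightarrow> r \<le> q \<longrightarrow> r = q)"
proof -
  define A where "A = {q. sublinear q \<and> q \<le> p}"
  have "\<exists>m\<in>A. \<forall>a\<in>A. a \<le> m \<longrightarrow> a = m"
  proof (rule predicate_Zorn)
    show "partial_order_on A (relation_of (\<lambda>q r. r \<le> q) A)"
      by (rule partial_order_on_relation_ofI) auto
    fix C assume C: "C \<in> Chains (relation_of (\<lambda>q r. r \<le> q) A)"
    show "\<exists>u\<in>A. \<forall>a\<in>C. u \<le> a"
    proof (cases "C = {}")
      case True
      then show ?thesis using p by (auto simp: A_def)
    next
      case False
      have CA: "q \<in> A" if "q \<in> C" for q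
        using C that by (auto simp: Chains_def relation_of_def)
      have chain: "q \<le> r \<or> r \<le> q" if "q \<in> C" "r \<in> C" for q r
        using C that by (auto simp: Chains_def relation_of_def)
      define u where "u x = (INF q\<in>C. q x)" for x
      have lower: "- p (- x) \<le> q x" if "q \<in> C" for q x
        using CA[OF that] sublinear_minus[of q x] by (auto simp: A_def le_fun_def intro: order_trans[rotated])
      have u_le: "u x \<le> q x" if "q \<in> C" for q x
        unfolding u_def using that lower by (intro cINF_lower bdd_belowI[where m = "- p (- x)"]) auto
      have u_greatest: "m \<le> u x" if "\<And>q. q \<in> C \<Longrightarrow> m \<le> q x" for m x
        unfolding u_def using that False by (intro cINF_greatest) auto
      have "sublinear u"
        unfolding sublinear_def
      proof (intro conjI allI impI)
        fix x y
        have *: "u (x + y) \<le> q x + r y" if qr: "q \<in> C" "r \<in> C" for q r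
        proof -
          \<comment> \<open>Being a chain, \<open>C\<close> contains the smaller of \<open>q\<close> and \<open>r\<close>; subadditivity is applied to that one.\<close>
          obtain s where "s \<in> C" "s \<le> q" "s \<le> r"
            using chain[OF qr] qr by auto
          then have "u (x + y) \<le> s x + s y"
            using u_le[of s "x + y"] sublinear_add[of s x y] CA[of s] by (auto simp: A_def)
          with \<open>s \<le> q\<close> \<open>s \<le> r\<close> show ?thesis
            by (auto simp: le_fun_def intro: order_trans[OF _ add_mono])
        qed
        have "u (x + y) - q x \<le> u y" if "q \<in> C" for q
          using *[OF that] by (intro u_greatest) (simp add: algebra_simps)
        then have "u (x + y) - u y \<le> u x"
          by (intro u_greatest) (simp add: algebra_simps)
        then show "u (x + y) \<le> u x + u y"
          by simp
      next
        fix c :: real and x assume c: "0 \<le> c"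
        show "u (c *\<^sub>R x) \<le> c * u x"
        proof (cases "c = 0")
          case True
          obtain q where "q \<in> C" using False by auto
          then show ?thesis
            using True u_le[of q 0] CA[of q] sublinear_0[of q] by (auto simp: A_def)
        next
          case False
          have "u (c *\<^sub>R x) / c \<le> q x" if "q \<in> C" for q
            using u_le[OF that, of "c *\<^sub>R x"] CA[OF that] sublinear_scale[of q c x] c False
            by (auto simp: A_def field_simps)
          then have "u (c *\<^sub>R x) / c \<le> u x"
            by (rule u_greatest)
          then show ?thesis
            using c False by (simp add: field_simps)
        qed
      qed
      moreover have "u \<le> p"
      proof -
        obtain q where "q \<in> C" using False by auto
        with u_le[of q] CA[of q] show ?thesis
          by (auto simp: A_def le_fun_def intro: order_trans)
      qed
      ultimately show ?thesis
        using u_le by (intro bexI[of _ u]) (auto simp: A_def le_fun_def)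
    qed
  qed
  then show ?thesis
    unfolding A_def by (blast intro: order_trans)
qed

text \<open>Minimality forces \<open>q\<close> to agree with its tilt along every \<open>b\<close>, which is superadditivity in the
  direction \<open>b\<close>.\<close>

lemma minimal_sublinear_linear:
  assumes q: "sublinear q" and min: "\<And>r. sublinear r \<Longrightarrow> r \<le> q \<Longrightarrow> r = q"
  shows "linear q"
proof -
  have add: "q (x + b) = q x + q b" for x b
  proof -
    have "tilt q b = q"
      using tilt_le[OF q, of 0 b] by (intro min sublinear_tilt q) (auto simp: le_fun_def)
    then have "q x \<le> q (x + b) - q b"
      using tilt_le[OF q, of 1 b x] by simp
    with sublinear_add[OF q, of x b] show ?thesis by simp
  qed
  have minus: "q (- x) = - q x" for x
    using add[of x "- x"] sublinear_0[OF q] by simp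
  have "q (c *\<^sub>R x) = c * q x" for c x
  proof (cases "0 \<le> c")
    case False
    then show ?thesis
      using sublinear_scale[OF q, of "- c" x] minus[of "c *\<^sub>R x"] by simp
  qed (simp add: sublinear_scale[OF q])
  with add show ?thesis
    by (intro linearI) auto
qed

text \<open>A minimal sublinear function below the tilt of \<open>p\<close> along \<open>b\<close> is linear and at most \<open>- p b\<close> at \<open>- b\<close>,
  so that it must touch \<open>p\<close> at \<open>b\<close>.\<close>

lemma hahn_banach:
  fixes p :: "'a::real_vector \<Rightarrow> real"
  assumes p: "sublinear p"
  shows "\<exists>f. linear f \<and> (\<forall>x. f x \<le> p x) \<and> f b = p b"
proof -
  obtain f where f: "sublinear f" "f \<le> tilt p b" and min: "\<And>r. sublinear r \<Longrightarrow> r \<le> f \<Longrightarrow> r = f"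
    using ex_minimal_sublinear[OF sublinear_tilt[OF p, of b]] by blast
  have lin: "linear f"
    using minimal_sublinear_linear[OF f(1) min] .
  have le: "f x \<le> p x" for x
    using f(2) tilt_le[OF p, of 0 b x] by (auto simp: le_fun_def intro: order_trans)
  have "f (- b) \<le> - p b"
    using f(2) tilt_le[OF p, of 1 b "- b"] sublinear_0[OF p] by (auto simp: le_fun_def intro: order_trans)
  then have "f b = p b"
    using le[of b] linear_neg[OF lin, of b] by simp
  with lin le show ?thesis by blast
qed

lemma ex_blinfun_of_dominated:
  fixes p :: "'a::real_normed_vector \<Rightarrow> real"
  assumes p: "sublinear p" and le: "\<And>x. p x \<le> norm x"
  shows "\<exists>f :: 'a \<Rightarrow>\<^sub>L real. norm f \<le> 1 \<and> (\<forall>x. blinfun_apply f x \<le> p x) \<and> blinfun_apply f b = p b"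
proof -
  obtain f where f: "linear f" "\<And>x. f x \<le> p x" "f b = p b"
    using hahn_banach[OF p] by blast
  have bnd: "norm (f x) \<le> 1 * norm x" for x
    using f(2)[of x] f(2)[of "- x"] le[of x] le[of "- x"] linear_neg[OF f(1), of x] by auto
  have "bounded_linear f"
    using f(1) bnd by (intro bounded_linear_intro[where K = 1])
      (auto simp: linear_add linear_scale)
  then obtain F :: "'a \<Rightarrow>\<^sub>L real" where F: "blinfun_apply F = f"
    by (metis bounded_linear_Blinfun_apply)
  with f bnd show ?thesis
    by (intro exI[of _ F] conjI norm_blinfun_bound) auto
qed

lemma ex_norming_functional:
  fixes b :: "'a::real_normed_vector"
  shows "\<exists>f :: 'a \<Rightarrow>\<^sub>L real. norm f \<le> 1 \<and> blinfun_apply f b = norm b"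
  using ex_blinfun_of_dominated[of norm b]
  by (auto simp: sublinear_def norm_triangle_ineq)

lemma eq_if_functionals_agree:
  fixes a b :: "'a::real_normed_vector"
  assumes "\<And>f :: 'a \<Rightarrow>\<^sub>L real. blinfun_apply f a = blinfun_apply f b"
  shows "a = b"
proof -
  obtain f :: "'a \<Rightarrow>\<^sub>L real" where "blinfun_apply f (a - b) = norm (a - b)"
    using ex_norming_functional by blast
  then show ?thesis
    using assms[of f] by (simp add: blinfun.diff_right)
qed

lemma sublinear_infdist:
  fixes V :: "'a::real_normed_vector set"
  assumes V: "subspace V"
  shows "sublinear (\<lambda>x. infdist x V)"
proof -
  have ne: "V \<noteq> {}" using subspace_0[OF V] by auto
  have approx: "\<exists>v\<in>V. dist x v < infdist x V + e" if "0 < e" for x e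
  proof (rule ccontr)
    assume "\<not> ?thesis"
    then have "infdist x V + e \<le> infdist x V"
      using ne unfolding infdist_notempty[OF ne, of x] by (intro cINF_greatest) (auto simp: not_less)
    with that show False by simp
  qed
  show ?thesis
    unfolding sublinear_def
  proof (intro conjI allI impI)
    fix x y
    show "infdist (x + y) V \<le> infdist x V + infdist y V"
    proof (rule field_le_epsilon)
      fix e :: real assume "0 < e"
      obtain v w where v: "v \<in> V" "dist x v < infdist x V + e / 2"
        and w: "w \<in> V" "dist y w < infdist y V + e / 2"
        using approx[of "e / 2"] \<open>0 < e\<close> by (meson half_gt_zero)
      have "infdist (x + y) V \<le> dist (x + y) (v + w)"
        using v(1) w(1) by (intro infdist_le subspace_add[OF V])
      also have "\<dots> \<le> dist x v + dist y w"
        by (rule dist_triangle_add)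
      finally show "infdist (x + y) V \<le> infdist x V + infdist y V + e"
        using v(2) w(2) by simp
    qed
  next
    fix c :: real and x assume c: "0 \<le> c"
    show "infdist (c *\<^sub>R x) V \<le> c * infdist x V"
    proof (rule field_le_epsilon)
      fix e :: real assume "0 < e"
      obtain v where v: "v \<in> V" "dist x v < infdist x V + e / (c + 1)"
        using approx[of "e / (c + 1)" x] \<open>0 < e\<close> c by (auto simp: add_nonneg_pos)
      have "infdist (c *\<^sub>R x) V \<le> dist (c *\<^sub>R x) (c *\<^sub>R v)"
        using v(1) by (intro infdist_le subspace_scale[OF V])
      also have "\<dots> = c * dist x v"
        using c by (simp add: dist_norm flip: scaleR_diff_right)
      also have "\<dots> \<le> c * (infdist x V + e / (c + 1))"
        using v(2) c by (intro mult_left_mono) auto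
      also have "\<dots> \<le> c * infdist x V + e"
        using c \<open>0 < e\<close> by (simp add: field_simps)
      finally show "infdist (c *\<^sub>R x) V \<le> c * infdist x V + e" .
    qed
  qed
qed

text \<open>Hahn-Banach for the distance to \<open>V\<close>, which is sublinear, dominated by the norm, zero on \<open>V\<close> and
  positive at \<open>b\<close>.\<close>

lemma ex_separating_functional:
  fixes V :: "'a::real_normed_vector set"
  assumes V: "subspace V" "closed V" and b: "b \<notin> V"
  shows "\<exists>f :: 'a \<Rightarrow>\<^sub>L real. (\<forall>v\<in>V. blinfun_apply f v = 0) \<and> blinfun_apply f b \<noteq> 0"
proof -
  have "infdist x V \<le> norm x" for x
    using infdist_le[OF subspace_0[OF V(1)], of x] by simp
  then obtain f :: "'a \<Rightarrow>\<^sub>L real" where f: "\<And>x. blinfun_apply f x \<le> infdist x V" "blinfun_apply f b = infdist b V"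
    using ex_blinfun_of_dominated[OF sublinear_infdist[OF V(1)]] by blast
  have "blinfun_apply f v = 0" if "v \<in> V" for v
    using f(1)[of v] f(1)[of "- v"] that subspace_neg[OF V(1) that]
    by (simp add: blinfun.minus_right)
  moreover have "infdist b V \<noteq> 0"
    using V b in_closed_iff_infdist_zero[of V b] subspace_0[OF V(1)] by auto
  ultimately show ?thesis
    using f(2) by (intro exI[of _ f]) auto
qed

section \<open>From real functionals to functionals over the scalar field\<close>

text \<open>For complex scalars this is conjugation. Only multiplicativity of the norm enters: it makes
  multiplication by \<open>c\<close> a multiple of an isometry, and the adjoint of that map is multiplication by
  \<open>adjoint_scalar c\<close>. This treats all scalar fields at once.\<close>

definition adjoint_scalar :: "'k::real_normed_field \<Rightarrow> 'k" where
  "adjoint_scalar c = of_real ((norm c)\<^sup>2) / c"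

lemma norm_adjoint_scalar: "norm (adjoint_scalar c) = norm c"
  by (simp add: adjoint_scalar_def norm_divide norm_mult power2_eq_square)

lemma adjoint_scalar_adjoint_scalar: "adjoint_scalar (adjoint_scalar c) = c"
  using norm_adjoint_scalar[of c] by (simp add: adjoint_scalar_def)

lemma adjoint_scalar_mult: "adjoint_scalar (c * d) = adjoint_scalar c * adjoint_scalar d"
  by (simp add: adjoint_scalar_def norm_mult power_mult_distrib)

lemma adjoint_scalar_1: "adjoint_scalar 1 = 1"
  by (simp add: adjoint_scalar_def)

text \<open>By polarisation, multiplication by \<open>c\<close> scales the inner product by \<open>(norm c)\<^sup>2\<close>.\<close>

lemma inner_mult_adjoint_scalar:
  fixes a b c :: "'k::{real_normed_field, real_inner}"
  shows "inner (c * a) b = inner a (adjoint_scalar c * b)"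
proof (cases "c = 0")
  case False
  have polar: "inner (c * x) (c * y) = (norm c)\<^sup>2 * inner x y" for x y :: 'k
  proof -
    have "norm (c * x + c * y) = norm c * norm (x + y)"
      by (simp add: norm_mult flip: distrib_left)
    then show ?thesis
      by (simp add: dot_norm[of "c * x" "c * y"] dot_norm[of x y] norm_mult power_mult_distrib
          algebra_simps diff_divide_distrib add_divide_distrib)
  qed
  have "inner (c * a) b = inner (c * a) (c * (b / c))"
    using False by simp
  also have "\<dots> = inner a ((norm c)\<^sup>2 *\<^sub>R (b / c))"
    by (simp only: polar inner_scaleR_right)
  also have "(norm c)\<^sup>2 *\<^sub>R (b / c) = adjoint_scalar c * b"
    by (simp add: adjoint_scalar_def scaleR_conv_of_real)
  finally show ?thesis .
qed (simp add: adjoint_scalar_def)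

text \<open>Linearity is not visible in the formula; it is inherited from taking adjoints.\<close>

lemma linear_adjoint_scalar: "linear (adjoint_scalar :: 'k::{real_normed_field, real_inner} \<Rightarrow> 'k)"
proof (rule linearI)
  fix c d :: 'k and r :: real
  have *: "inner a (adjoint_scalar c) = inner (c * a) 1" for a c :: 'k
    by (simp add: inner_mult_adjoint_scalar)
  have "inner a (adjoint_scalar (c + d)) = inner a (adjoint_scalar c + adjoint_scalar d)" for a
    by (simp add: * inner_add_right distrib_right inner_add_left)
  then show "adjoint_scalar (c + d) = adjoint_scalar c + adjoint_scalar d"
    by (metis vector_eq_ldot)
  have "inner a (adjoint_scalar (r *\<^sub>R c)) = inner a (r *\<^sub>R adjoint_scalar c)" for a
    by (simp add: *)
  then show "adjoint_scalar (r *\<^sub>R c) = r *\<^sub>R adjoint_scalar c"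
    by (metis vector_eq_ldot)
qed

context banach_space_over
begin

lemma scale_scaleR: "sc c (r *\<^sub>R x) = r *\<^sub>R sc c x" "sc (r *\<^sub>R c) x = r *\<^sub>R sc c x"
  by (simp_all add: mult.commute scaleR_conv_of_real flip: scale_of_real)

lemma bounded_linear_scale_right: "bounded_linear (sc c)"
  by (rule bounded_linear_intro[where K = "norm c"])
    (auto simp: scale_right_distrib scale_scaleR norm_scale mult.commute)

lemma bounded_linear_scale_left: "bounded_linear (\<lambda>c. sc c x)"
  by (rule bounded_linear_intro[where K = "norm x"])
    (auto simp: scale_left_distrib scale_scaleR norm_scale)

lemma real_subspace_of_subspace: "subspace V \<Longrightarrow> Real_Vector_Spaces.subspace V"
  unfolding Real_Vector_Spaces.subspace_def subspace_def
  by (auto simp flip: scale_of_real)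

text \<open>This generalises \<open>f x = g x - \<i> g (\<i> x)\<close> from the complex case: the component of \<open>f x\<close> along \<open>c\<close>
  has to be the component along \<open>1\<close> of \<open>f\<close> at \<open>adjoint_scalar c\<close> times \<open>x\<close>, and prescribing these
  components makes \<open>f\<close> linear over the scalar field because \<open>adjoint_scalar\<close> is multiplicative and
  involutive.\<close>

lemma ex_dual_of_real_functional:
  fixes g :: "'x \<Rightarrow>\<^sub>L real"
  shows "\<exists>f\<in>dual_space sc. \<forall>x c.
    inner (blinfun_apply f x) c = blinfun_apply g (sc (adjoint_scalar c) x)"
proof -
  define h where "h x = (\<Sum>b\<in>Basis. blinfun_apply g (sc (adjoint_scalar b) x) *\<^sub>R b)" for x
  have "bounded_linear h"
    unfolding h_def
    by (intro bounded_linear_sum bounded_linear_scaleR_const bounded_linear_compose[OF blinfun.bounded_linear_right]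
        bounded_linear_scale_right)
  then obtain f where f: "blinfun_apply f = h"
    by (metis bounded_linear_Blinfun_apply)
  have h: "inner (h x) c = blinfun_apply g (sc (adjoint_scalar c) x)" for x c
  proof -
    have lin: "linear (\<lambda>c. blinfun_apply g (sc (adjoint_scalar c) x))"
      by (intro linearI)
        (simp_all add: linear_add[OF linear_adjoint_scalar] linear_scale[OF linear_adjoint_scalar]
          scale_left_distrib scale_scaleR blinfun.add_right blinfun.scaleR_right)
    have "blinfun_apply g (sc (adjoint_scalar c) x)
        = blinfun_apply g (sc (adjoint_scalar (\<Sum>b\<in>Basis. inner c b *\<^sub>R b)) x)"
      by (simp add: euclidean_representation)
    also have "\<dots> = (\<Sum>b\<in>Basis. inner c b * blinfun_apply g (sc (adjoint_scalar b) x))"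
      using linear_sum[OF lin, of "\<lambda>b. inner c b *\<^sub>R b" Basis] by (simp add: linear_scale[OF lin])
    finally show ?thesis
      by (simp add: h_def inner_commute[of _ c] inner_sum_right mult.commute)
  qed
  have "h (sc c x) = c * h x" for c x
  proof -
    have "inner (h (sc c x)) d = inner (c * h x) d" for d
      by (simp add: h inner_mult_adjoint_scalar adjoint_scalar_mult adjoint_scalar_adjoint_scalar mult.commute)
    then show ?thesis by (metis vector_eq_rdot)
  qed
  with h f show ?thesis
    by (intro bexI[of _ f]) (auto simp: dual_space_def)
qed

end

section \<open>Coordinates on finite-dimensional subspaces\<close>

context banach_space_over
begin

lemma dual_space_diff_mult:
  assumes "f \<in> dual_space sc" "g \<in> dual_space sc"
  shows "\<exists>h\<in>dual_space sc. \<forall>x. blinfun_apply h x = blinfun_apply f x - c * blinfun_apply g x"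
proof -
  have "bounded_linear (\<lambda>x. blinfun_apply f x - c * blinfun_apply g x)"
    by (intro bounded_linear_sub bounded_linear_mult_const bounded_linear_const_mult blinfun.bounded_linear_right)
  then obtain h where h: "blinfun_apply h = (\<lambda>x. blinfun_apply f x - c * blinfun_apply g x)"
    by (metis bounded_linear_Blinfun_apply)
  with assms show ?thesis
    by (intro bexI[of _ h]) (auto simp: dual_space_def algebra_simps)
qed

text \<open>The right-hand side is a closed condition on \<open>x\<close>: with dual functionals at hand, spans are closed.\<close>

lemma span_eq_dual_expansion:
  assumes "finite B" and dual: "\<And>b. b \<in> B \<Longrightarrow> f b \<in> dual_space sc"
    "\<And>b b'. b \<in> B \<Longrightarrow> b' \<in> B \<Longrightarrow> blinfun_apply (f b) b' = (if b = b' then 1 else 0)"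
  shows "x \<in> span B \<longleftrightarrow> (\<Sum>b\<in>B. sc (blinfun_apply (f b) x) b) = x"
proof
  assume "x \<in> span B"
  then obtain u where x: "x = (\<Sum>b\<in>B. sc (u b) b)"
    using \<open>finite B\<close> by (auto simp: span_finite)
  have "blinfun_apply (f b) x = u b" if "b \<in> B" for b
  proof -
    have "blinfun_apply (f b) x = (\<Sum>b'\<in>B. u b' * blinfun_apply (f b) b')"
      using dual(1)[OF that] by (simp add: x blinfun.sum_right dual_space_def)
    also have "\<dots> = (\<Sum>b'\<in>B. if b = b' then u b' else 0)"
      using dual(2)[OF that] by (intro sum.cong) auto
    finally show ?thesis
      using that \<open>finite B\<close> by simp
  qed
  then show "(\<Sum>b\<in>B. sc (blinfun_apply (f b) x) b) = x"
    by (simp add: x cong: sum.cong)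
next
  assume "(\<Sum>b\<in>B. sc (blinfun_apply (f b) x) b) = x"
  then show "x \<in> span B"
    by (metis (no_types, lifting) span_base span_scale span_sum)
qed

text \<open>By induction on the basis. The dual functionals of \<open>B\<close> make \<open>span B\<close> closed, so that some functional
  \<open>h\<close> vanishes on \<open>B\<close> and not at the new vector \<open>a\<close>. A multiple of \<open>h\<close> is dual to \<open>a\<close>, and subtracting
  multiples of \<open>h\<close> from the old functionals makes them vanish at \<open>a\<close>.\<close>

lemma ex_dual_basis:
  assumes "finite B" "independent B"
  shows "\<exists>f. (\<forall>b\<in>B. f b \<in> dual_space sc) \<and>
    (\<forall>b\<in>B. \<forall>b'\<in>B. blinfun_apply (f b) b' = (if b = b' then 1 else 0))"
  using assms
proof (induction B rule: finite_induct)
  case (insert a B)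
  then have a: "a \<notin> span B" and "independent B"
    by (auto simp: independent_insert)
  with insert.IH obtain f where f: "\<And>b. b \<in> B \<Longrightarrow> f b \<in> dual_space sc"
      "\<And>b b'. b \<in> B \<Longrightarrow> b' \<in> B \<Longrightarrow> blinfun_apply (f b) b' = (if b = b' then 1 else 0)"
    by blast
  have "span B = {x. (\<Sum>b\<in>B. sc (blinfun_apply (f b) x) b) = x}"
    using span_eq_dual_expansion[OF insert.hyps(1) f] by auto
  moreover have "closed {x. (\<Sum>b\<in>B. sc (blinfun_apply (f b) x) b) = x}"
    by (intro closed_Collect_eq continuous_on_sum continuous_on_id
        linear_continuous_on bounded_linear_compose[OF bounded_linear_scale_left blinfun.bounded_linear_right])
  ultimately have "closed (span B)" by simp
  then obtain g :: "'x \<Rightarrow>\<^sub>L real" where g: "\<And>v. v \<in> span B \<Longrightarrow> blinfun_apply g v = 0"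
      "blinfun_apply g a \<noteq> 0"
    using ex_separating_functional[OF real_subspace_of_subspace[OF subspace_span] _ a] by blast
  obtain h where h: "h \<in> dual_space sc"
      "\<And>x c. inner (blinfun_apply h x) c = blinfun_apply g (sc (adjoint_scalar c) x)"
    using ex_dual_of_real_functional[of g] by blast
  have ha: "blinfun_apply h a \<noteq> 0"
    using h(2)[of a 1] g(2) by (auto simp: adjoint_scalar_1)
  have hB: "blinfun_apply h b = 0" if "b \<in> B" for b
  proof -
    have "inner (blinfun_apply h b) c = 0" for c
      using h(2)[of b c] g(1) that by (simp add: span_base span_scale)
    then show ?thesis by (metis inner_eq_zero_iff)
  qed
  \<comment> \<open>The case distinctions in \<open>k\<close> and \<open>f0\<close> give every new dual functional the same form \<open>f0 b - k b * h\<close>.\<close>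
  define k where "k b = (if b = a then - inverse (blinfun_apply h a)
    else blinfun_apply (f b) a / blinfun_apply h a)" for b
  define f0 where "f0 b = (if b = a then 0 else f b)" for b
  have "\<exists>F. \<forall>b\<in>insert a B. F b \<in> dual_space sc \<and>
      (\<forall>x. blinfun_apply (F b) x = blinfun_apply (f0 b) x - k b * blinfun_apply h x)"
  proof (rule bchoice, rule ballI)
    fix b assume "b \<in> insert a B"
    then have "f0 b \<in> dual_space sc"
      using f(1) by (auto simp: f0_def dual_space_def)
    from dual_space_diff_mult[OF this h(1)]
    show "\<exists>F. F \<in> dual_space sc \<and>
      (\<forall>x. blinfun_apply F x = blinfun_apply (f0 b) x - k b * blinfun_apply h x)"
      by blast
  qed
  then obtain F where F: "\<And>b. b \<in> insert a B \<Longrightarrow> F b \<in> dual_space sc"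
    "\<And>b x. b \<in> insert a B \<Longrightarrow>
      blinfun_apply (F b) x = blinfun_apply (f0 b) x - k b * blinfun_apply h x"
    by blast
  have "blinfun_apply (F b) b' = (if b = b' then 1 else 0)"
    if b: "b \<in> insert a B" and b': "b' \<in> insert a B" for b b'
    unfolding F(2)[OF b] using b b' ha hB f(2) insert.hyps(2)
    by (auto simp: f0_def k_def)
  with F(1) show ?case by blast
qed auto

lemma finite_dim_subspace_basis:
  assumes "finite_dim_subspace sc Y"
  obtains B where "finite B" "independent B" "span B = Y"
proof -
  obtain C where C: "finite C" "Y = span C"
    using assms by (auto simp: finite_dim_subspace_def)
  obtain B where "B \<subseteq> C" "independent B" "C \<subseteq> span B"
    using maximal_independent_subset by blast
  then show ?thesis
    using that[of B] C finite_subset span_mono span_minimal[of C "span B"] by blast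
qed

lemma ex_projection:
  assumes "finite_dim_subspace sc Y"
  shows "projections sc Y \<noteq> {}"
proof -
  obtain B where B: "finite B" "independent B" "span B = Y"
    using finite_dim_subspace_basis[OF assms] .
  obtain f where f: "\<And>b. b \<in> B \<Longrightarrow> f b \<in> dual_space sc"
      "\<And>b b'. b \<in> B \<Longrightarrow> b' \<in> B \<Longrightarrow> blinfun_apply (f b) b' = (if b = b' then 1 else 0)"
    using ex_dual_basis[OF B(1,2)] by blast
  define p where "p x = (\<Sum>b\<in>B. sc (blinfun_apply (f b) x) b)" for x
  have "bounded_linear p"
    unfolding p_def
    by (intro bounded_linear_sum bounded_linear_compose[OF bounded_linear_scale_left blinfun.bounded_linear_right])
  then obtain P where P: "blinfun_apply P = p"
    by (metis bounded_linear_Blinfun_apply)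
  have "p (sc c x) = sc c (p x)" for c x
    using f(1) by (simp add: p_def scale_sum_right dual_space_def)
  moreover have "p x \<in> Y" for x
    unfolding p_def B(3)[symmetric] by (intro span_sum span_scale span_base)
  moreover have "p y = y" if "y \<in> Y" for y
    using span_eq_dual_expansion[OF B(1) f] that B(3) by (auto simp: p_def)
  ultimately have "P \<in> projections sc Y"
    by (auto simp: projections_def bounded_operators_def P)
  then show ?thesis by blast
qed

text \<open>Means are real-valued, so averaging uses real coordinates on \<open>Y\<close>. The products of a real basis of
  the scalar field with a spanning set of \<open>Y\<close> span \<open>Y\<close> over the reals.\<close>

lemma finite_dim_subspace_real:
  assumes "finite_dim_subspace sc Y"
  shows "finite_dim_subspace scaleR Y"
proof -
  obtain B where B: "finite B" "span B = Y"
    using finite_dim_subspace_basis[OF assms] .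
  define C where "C = (\<lambda>(e, b). sc e b) ` (Basis \<times> B)"
  have "Real_Vector_Spaces.span C = Y"
  proof
    have "C \<subseteq> Y"
      unfolding C_def B(2)[symmetric] by (auto intro: span_scale span_base)
    moreover have "Real_Vector_Spaces.subspace Y"
      using B(2) real_subspace_of_subspace[OF subspace_span] by auto
    ultimately show "Real_Vector_Spaces.span C \<subseteq> Y"
      by (rule Real_Vector_Spaces.span_minimal)
    show "Y \<subseteq> Real_Vector_Spaces.span C"
    proof
      fix y assume "y \<in> Y"
      then obtain u where y: "y = (\<Sum>b\<in>B. sc (u b) b)"
        using B by (auto simp: span_finite)
      have "sc (u b) b \<in> Real_Vector_Spaces.span C" if "b \<in> B" for b
      proof -
        have "sc (u b) b = sc (\<Sum>e\<in>Basis. inner (u b) e *\<^sub>R e) b"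
          by (simp add: euclidean_representation)
        also have "\<dots> = (\<Sum>e\<in>Basis. inner (u b) e *\<^sub>R sc e b)"
          by (simp only: scale_sum_left scale_scaleR)
        also have "\<dots> \<in> Real_Vector_Spaces.span C"
          using that by (intro Real_Vector_Spaces.span_sum Real_Vector_Spaces.span_scale
              Real_Vector_Spaces.span_base) (auto simp: C_def)
        finally show ?thesis .
      qed
      then show "y \<in> Real_Vector_Spaces.span C"
        unfolding y by (rule Real_Vector_Spaces.span_sum)
    qed
  qed
  then show ?thesis
    unfolding finite_dim_subspace_def span_raw_def[symmetric]
    using B(1) by (intro exI[of _ C]) (auto simp: C_def)
qed

end

lemma finite_dim_coordinates:
  fixes Y :: "'a::banach set"
  assumes Y: "finite_dim_subspace scaleR Y"
  shows "\<exists>B (coord :: 'a \<Rightarrow> 'a \<Rightarrow>\<^sub>L real). finite B \<and> B \<subseteq> Y \<and>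
    (\<forall>y. y \<in> Y \<longleftrightarrow> (\<Sum>b\<in>B. blinfun_apply (coord b) y *\<^sub>R b) = y)"
proof -
  interpret real: banach_space_over "scaleR :: real \<Rightarrow> 'a \<Rightarrow> 'a"
    by (simp add: banach_space_over_real)
  obtain B where B: "finite B" "independent B" "span B = Y"
    using real.finite_dim_subspace_basis[OF Y] by (auto simp: dependent_raw_def span_raw_def)
  obtain f where f: "\<And>b. b \<in> B \<Longrightarrow> f b \<in> dual_space scaleR"
      "\<And>b b'. b \<in> B \<Longrightarrow> b' \<in> B \<Longrightarrow> blinfun_apply (f b) b' = (if b = b' then 1 else 0)"
    using real.ex_dual_basis[OF B(1) B(2)[unfolded dependent_raw_def]] by blast
  have "y \<in> Y \<longleftrightarrow> (\<Sum>b\<in>B. blinfun_apply (f b) y *\<^sub>R b) = y" for y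
    using real.span_eq_dual_expansion[OF B(1) f] B(3) by (simp add: span_raw_def)
  with B span_superset[of B] show ?thesis
    by blast
qed

lemma inj_on_of_image_eq:
  assumes lin: "linear L" and Y: "finite_dim_subspace scaleR Y" and im: "L ` Y = Y"
  shows "inj_on L Y"
proof -
  interpret real: banach_space_over "scaleR :: real \<Rightarrow> 'a \<Rightarrow> 'a"
    by (simp add: banach_space_over_real)
  obtain B where B: "finite B" "independent B" "span B = Y"
    using real.finite_dim_subspace_basis[OF Y]
    by (auto simp: dependent_raw_def span_raw_def)
  obtain C where C: "C \<subseteq> L ` B" "independent C" "L ` B \<subseteq> span C"
    using maximal_independent_subset by blast
  have spanC: "span C = Y"
    using C(1,3) linear_span_image[OF lin, of B] im B(3) span_mono[OF C(1)] span_minimal[OF C(3)]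
    by auto
  have "card B = card C"
    using dim_span_eq_card_independent[OF B(2)] dim_span_eq_card_independent[OF C(2)] B(3) spanC
    by simp
  then have "C = L ` B" and card: "card (L ` B) = card B"
    using C(1) B(1) by (metis card_image_le card_mono card_subset_eq finite_imageI le_antisym)+
  then have "inj_on L B" "independent (L ` B)"
    using eq_card_imp_inj_on[OF B(1) card] C(2) by auto
  then show ?thesis
    using linear_inj_on_span_iff_independent_image[OF lin] B(3) by metis
qed

section \<open>Conjugates of a projection under the action\<close>

text \<open>A projection \<open>P\<close> that is to be averaged, with real coordinates \<open>coord\<close> on \<open>Y\<close>. Weak continuity is
  stated with real functionals; it is the common consequence of both continuity hypotheses on \<open>T\<close>.\<close>

locale averaging = banach_space_over sc
  for sc :: "'k::{real_normed_field, euclidean_space} \<Rightarrow> 'x::banach \<Rightarrow> 'x" +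
  fixes T :: "'s::{semigroup_mult, topological_space} \<Rightarrow> ('x \<Rightarrow>\<^sub>L 'x)"
    and Y :: "'x set" and P :: "'x \<Rightarrow>\<^sub>L 'x"
    and B :: "'x set" and coord :: "'x \<Rightarrow> ('x \<Rightarrow>\<^sub>L real)"
  assumes operators: "\<And>s. T s \<in> bounded_operators sc"
    and hom: "\<And>s t. T (s * t) = T s o\<^sub>L T t"
    and fin_dim: "finite_dim_subspace sc Y"
    and image_Y: "\<And>s. blinfun_apply (T s) ` Y = Y"
    and bdd: "bdd_above (range (m_term Y T))"
    and weakly_continuous:
      "\<And>(h :: 'x \<Rightarrow>\<^sub>L real) x. continuous_on UNIV (\<lambda>s. blinfun_apply h (blinfun_apply (T s) x))"
    and P: "P \<in> projections sc Y"
    and B_subset: "B \<subseteq> Y"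
    and expansion: "\<And>y. y \<in> Y \<Longrightarrow> (\<Sum>b\<in>B. blinfun_apply (coord b) y *\<^sub>R b) = y"
begin

lemma subspace_Y: "subspace Y"
  using fin_dim by (auto simp: finite_dim_subspace_def)

lemma real_subspace_Y: "Real_Vector_Spaces.subspace Y"
  using real_subspace_of_subspace[OF subspace_Y] .

lemma T_scale: "blinfun_apply (T s) (sc c x) = sc c (blinfun_apply (T s) x)"
  using operators by (simp add: bounded_operators_def)

lemma T_in_Y: "y \<in> Y \<Longrightarrow> blinfun_apply (T s) y \<in> Y"
  using image_Y by blast

lemma P_in_Y: "blinfun_apply P x \<in> Y"
  using P by (auto simp: projections_def)

lemma P_fix: "y \<in> Y \<Longrightarrow> blinfun_apply P y = y"
  using P by (auto simp: projections_def)

lemma P_scale: "blinfun_apply P (sc c x) = sc c (blinfun_apply P x)"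
  using P by (auto simp: projections_def bounded_operators_def)

abbreviation R :: "'s \<Rightarrow> 'x \<Rightarrow> 'x" where
  "R s \<equiv> inv_into Y (blinfun_apply (T s))"

lemma inj_on_T: "inj_on (blinfun_apply (T s)) Y"
  by (rule inj_on_of_image_eq[OF _ finite_dim_subspace_real[OF fin_dim] image_Y])
    (simp add: blinfun.bounded_linear_right bounded_linear.linear)

lemma R_in_Y: "y \<in> Y \<Longrightarrow> R s y \<in> Y"
  by (rule inv_into_into) (simp add: image_Y)

lemma T_R: "y \<in> Y \<Longrightarrow> blinfun_apply (T s) (R s y) = y"
  by (rule f_inv_into_f) (simp add: image_Y)

lemma R_eqI: "z \<in> Y \<Longrightarrow> blinfun_apply (T s) z = y \<Longrightarrow> R s y = z"
  using inj_on_T by (rule inv_into_f_eq)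

lemma R_add: "y \<in> Y \<Longrightarrow> z \<in> Y \<Longrightarrow> R s (y + z) = R s y + R s z"
  by (intro R_eqI) (simp_all add: blinfun.add_right T_R R_in_Y subspace_add[OF subspace_Y])

lemma R_scale: "y \<in> Y \<Longrightarrow> R s (sc c y) = sc c (R s y)"
  by (intro R_eqI) (simp_all add: T_scale T_R R_in_Y subspace_scale[OF subspace_Y])

lemma R_scaleR: "y \<in> Y \<Longrightarrow> R s (r *\<^sub>R y) = r *\<^sub>R R s y"
  using R_scale[of y s "of_real r"] by (simp add: scale_of_real)

lemma R_mult: "y \<in> Y \<Longrightarrow> R (s * u) y = R u (R s y)"
  by (intro R_eqI) (simp_all add: hom T_R R_in_Y)

lemma R_sum:
  assumes "\<And>b. b \<in> B' \<Longrightarrow> f b \<in> Y"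
  shows "R s (\<Sum>b\<in>B'. f b) = (\<Sum>b\<in>B'. R s (f b))"
proof (rule R_eqI)
  show "(\<Sum>b\<in>B'. R s (f b)) \<in> Y"
    using assms by (intro subspace_sum[OF subspace_Y] R_in_Y)
  show "blinfun_apply (T s) (\<Sum>b\<in>B'. R s (f b)) = (\<Sum>b\<in>B'. f b)"
    using assms by (simp add: blinfun.sum_right T_R cong: sum.cong)
qed

lemma R_expansion:
  assumes "y \<in> Y"
  shows "R s y = (\<Sum>b\<in>B. blinfun_apply (coord b) y *\<^sub>R R s b)"
proof -
  have "R s y = R s (\<Sum>b\<in>B. blinfun_apply (coord b) y *\<^sub>R b)"
    by (simp add: expansion[OF assms])
  also have "\<dots> = (\<Sum>b\<in>B. R s (blinfun_apply (coord b) y *\<^sub>R b))"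
    using B_subset by (intro R_sum Real_Vector_Spaces.subspace_scale[OF real_subspace_Y]) auto
  also have "\<dots> = (\<Sum>b\<in>B. blinfun_apply (coord b) y *\<^sub>R R s b)"
    using B_subset by (intro sum.cong R_scaleR) auto
  finally show ?thesis .
qed

text \<open>The content is that the supremum defining the operator norm of \<open>R s\<close> on \<open>Y\<close> is over a bounded
  set, by the expansion of \<open>R s\<close> in coordinates.\<close>

lemma ratio_le_onorm_on_R:
  assumes "y \<in> Y"
  shows "norm (R s y) / norm y \<le> onorm_on Y (R s)"
proof -
  define K where "K = (\<Sum>b\<in>B. norm (coord b) * norm (R s b))"
  have K: "norm (R s z) / norm z \<le> K" if "z \<in> Y" for z
  proof (cases "z = 0")
    case False
    have "norm (R s z) \<le> (\<Sum>b\<in>B. norm (blinfun_apply (coord b) z *\<^sub>R R s b))"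
      unfolding R_expansion[OF that] by (rule norm_sum)
    also have "\<dots> \<le> (\<Sum>b\<in>B. (norm (coord b) * norm z) * norm (R s b))"
      unfolding norm_scaleR real_norm_def[symmetric]
      by (intro sum_mono mult_right_mono norm_blinfun norm_ge_zero)
    also have "\<dots> = K * norm z"
      by (simp add: K_def sum_distrib_left sum_distrib_right mult_ac)
    finally show ?thesis
      using False by (simp add: field_simps)
  qed (simp add: K_def sum_nonneg)
  show ?thesis
    unfolding onorm_on_def using assms K by (intro cSUP_upper bdd_aboveI2[of _ _ K]) auto
qed

lemma R_0: "R s 0 = 0"
  using subspace_0[OF subspace_Y] by (intro R_eqI) (simp_all add: blinfun.zero_right)

lemma norm_R_le:
  assumes "y \<in> Y"
  shows "norm (R s y) \<le> onorm_on Y (R s) * norm y"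
  using ratio_le_onorm_on_R[OF assms, of s] by (cases "y = 0") (simp_all add: R_0 field_simps)

lemma onorm_on_R_nonneg: "0 \<le> onorm_on Y (R s)"
  using ratio_le_onorm_on_R[of 0 s] subspace_0[OF subspace_Y] by simp

lemma m_term_le: "m_term Y T s \<le> m_const Y T"
  unfolding m_const_def by (intro cSUP_upper bdd) auto

lemma m_const_nonneg: "0 \<le> m_const Y T"
proof -
  have "0 \<le> m_term Y T undefined"
    unfolding m_term_def by (intro mult_nonneg_nonneg norm_ge_zero onorm_on_R_nonneg)
  then show ?thesis
    using m_term_le by (rule order_trans)
qed

lemma norm_T_norm_R_le:
  assumes "y \<in> Y"
  shows "norm (T s) * norm (R s y) \<le> m_const Y T * norm y"
proof -
  have "norm (T s) * norm (R s y) \<le> norm (T s) * (onorm_on Y (R s) * norm y)"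
    by (intro mult_left_mono norm_R_le assms norm_ge_zero)
  also have "\<dots> = m_term Y T s * norm y"
    by (simp add: m_term_def)
  also have "\<dots> \<le> m_const Y T * norm y"
    by (intro mult_right_mono m_term_le norm_ge_zero)
  finally show ?thesis .
qed

lemma norm_R_norm_T_le:
  assumes "y \<in> Y"
  shows "norm (R s y) * norm (blinfun_apply (T s) x) \<le> m_const Y T * norm y * norm x"
proof -
  have "norm (R s y) * norm (blinfun_apply (T s) x) \<le> norm (R s y) * (norm (T s) * norm x)"
    by (intro mult_left_mono norm_blinfun norm_ge_zero)
  also have "\<dots> = norm (T s) * norm (R s y) * norm x"
    by simp
  also have "\<dots> \<le> m_const Y T * norm y * norm x"
    by (intro mult_right_mono norm_T_norm_R_le assms norm_ge_zero)
  finally show ?thesis .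
qed

lemma continuous_on_Y_valued:
  assumes "\<And>s. f s \<in> Y" "\<And>b. b \<in> B \<Longrightarrow> continuous_on UNIV (\<lambda>s. blinfun_apply (coord b) (f s))"
  shows "continuous_on UNIV f"
proof -
  have "continuous_on UNIV (\<lambda>s. \<Sum>b\<in>B. blinfun_apply (coord b) (f s) *\<^sub>R b)"
    using assms(2) by (intro continuous_on_sum continuous_on_scaleR continuous_on_const)
  then show ?thesis
    by (simp add: expansion assms(1))
qed

lemma continuous_T_on_Y: "y \<in> Y \<Longrightarrow> continuous_on UNIV (\<lambda>s. blinfun_apply (T s) y)"
  by (rule continuous_on_Y_valued[OF T_in_Y weakly_continuous])

text \<open>With \<open>z = R v y\<close> one has \<open>R s y - z = R s (y - T s z)\<close>. The bound \<open>norm_R_norm_T_le\<close>, tested on \<open>z\<close>,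
  estimates this by a constant times \<open>norm (y - T s z) / norm (T s z)\<close>, where \<open>T s z\<close> tends to
  \<open>T v z = y\<close>. So finiteness of \<open>m_const Y T\<close> replaces a local bound on the inverses.\<close>

lemma continuous_R:
  assumes y: "y \<in> Y"
  shows "continuous_on UNIV (\<lambda>s. R s y)"
  unfolding continuous_on_def
proof (intro ballI)
  fix v
  define z where "z = R v y"
  have z: "z \<in> Y" "blinfun_apply (T v) z = y"
    by (simp_all add: z_def R_in_Y T_R y)
  have lim: "((\<lambda>s. blinfun_apply (T s) z) \<longlongrightarrow> y) (at v)"
    using continuous_T_on_Y[OF z(1)] z(2) by (auto simp: continuous_on_def)
  show "((\<lambda>s. R s y) \<longlongrightarrow> R v y) (at v)"
  proof (cases "y = 0")
    case True
    then show ?thesis by (simp add: R_0)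
  next
    case False
    have le: "norm (R s y - z) \<le> m_const Y T * norm (y - blinfun_apply (T s) z) * norm z /
        norm (blinfun_apply (T s) z)" if "blinfun_apply (T s) z \<noteq> 0" for s
    proof -
      have in_Y: "y - blinfun_apply (T s) z \<in> Y"
        using y T_in_Y[OF z(1)] by (intro subspace_diff[OF subspace_Y])
      have "R s (y - blinfun_apply (T s) z) = R s y - z"
        using in_Y y z(1) by (intro R_eqI) (auto simp: blinfun.diff_right T_R R_in_Y intro: subspace_diff[OF subspace_Y])
      then have "norm (R s y - z) * norm (blinfun_apply (T s) z)
          \<le> m_const Y T * norm (y - blinfun_apply (T s) z) * norm z"
        using norm_R_norm_T_le[OF in_Y, of s z] by simp
      then show ?thesis
        using that by (simp add: pos_le_divide_eq)
    qed
    have "((\<lambda>s. m_const Y T * norm (y - blinfun_apply (T s) z) * norm z /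
        norm (blinfun_apply (T s) z)) \<longlongrightarrow> m_const Y T * norm (y - y) * norm z / norm y) (at v)"
      using False by (intro tendsto_intros lim) simp
    then have "((\<lambda>s. m_const Y T * norm (y - blinfun_apply (T s) z) * norm z /
        norm (blinfun_apply (T s) z)) \<longlongrightarrow> 0) (at v)"
      by simp
    with eventually_mono[OF tendsto_imp_eventually_ne[OF lim False] le]
    have "((\<lambda>s. R s y - z) \<longlongrightarrow> 0) (at v)"
      by (rule Lim_null_comparison)
    then show ?thesis
      by (simp add: z_def LIM_zero_iff)
  qed
qed

definition conj_proj :: "'s \<Rightarrow> 'x \<Rightarrow> 'x" where
  "conj_proj s x = R s (blinfun_apply P (blinfun_apply (T s) x))"

lemma conj_proj_in_Y: "conj_proj s x \<in> Y"
  by (simp add: conj_proj_def R_in_Y P_in_Y)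

lemma conj_proj_add: "conj_proj s (x + y) = conj_proj s x + conj_proj s y"
  by (simp add: conj_proj_def blinfun.add_right R_add P_in_Y)

lemma conj_proj_scale: "conj_proj s (sc c x) = sc c (conj_proj s x)"
  by (simp add: conj_proj_def T_scale P_scale R_scale P_in_Y)

lemma conj_proj_fix: "y \<in> Y \<Longrightarrow> conj_proj s y = y"
  by (simp add: conj_proj_def P_fix T_in_Y R_eqI)

text \<open>This right translation formula is the source of equivariance of the average.\<close>

lemma conj_proj_mult: "conj_proj (s * u) x = R u (conj_proj s (blinfun_apply (T u) x))"
  using R_mult[OF P_in_Y] by (simp add: conj_proj_def hom)

lemma norm_conj_proj_le: "norm (conj_proj s x) \<le> m_const Y T * norm P * norm x"
proof -
  have "norm (conj_proj s x) \<le> onorm_on Y (R s) * norm (blinfun_apply P (blinfun_apply (T s) x))"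
    unfolding conj_proj_def by (intro norm_R_le P_in_Y)
  also have "\<dots> \<le> onorm_on Y (R s) * (norm P * (norm (T s) * norm x))"
    by (intro mult_left_mono onorm_on_R_nonneg order_trans[OF norm_blinfun] norm_blinfun norm_ge_zero)
  also have "\<dots> = m_term Y T s * (norm P * norm x)"
    by (simp add: m_term_def)
  also have "\<dots> \<le> m_const Y T * (norm P * norm x)"
    by (intro mult_right_mono m_term_le) simp
  finally show ?thesis by (simp add: mult.assoc)
qed

lemma continuous_conj_proj: "continuous_on UNIV (\<lambda>s. conj_proj s x)"
proof -
  have "continuous_on UNIV (\<lambda>s. blinfun_apply (coord b) (blinfun_apply P (blinfun_apply (T s) x)))" for b
    using weakly_continuous[of "coord b o\<^sub>L P" x] by simp
  then have "continuous_on UNIV (\<lambda>s. \<Sum>b\<in>B.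
      blinfun_apply (coord b) (blinfun_apply P (blinfun_apply (T s) x)) *\<^sub>R R s b)"
    using B_subset by (intro continuous_on_sum continuous_on_scaleR continuous_R) auto
  then show ?thesis
    by (simp add: conj_proj_def R_expansion[OF P_in_Y, symmetric])
qed

section \<open>Orbit functions\<close>

definition orbit_fun :: "('x \<Rightarrow>\<^sub>L real) \<Rightarrow> 'x \<Rightarrow> ('s \<Rightarrow>\<^sub>C real)" where
  "orbit_fun \<xi> x = Bcontfun (\<lambda>s. blinfun_apply \<xi> (conj_proj s x))"

lemma abs_conj_proj_le:
  "\<bar>blinfun_apply \<xi> (conj_proj s x)\<bar> \<le> norm \<xi> * norm x * (m_const Y T * norm P)"
proof -
  have "\<bar>blinfun_apply \<xi> (conj_proj s x)\<bar> \<le> norm \<xi> * norm (conj_proj s x)"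
    using norm_blinfun[of \<xi> "conj_proj s x"] by simp
  also have "\<dots> \<le> norm \<xi> * (m_const Y T * norm P * norm x)"
    by (intro mult_left_mono norm_conj_proj_le norm_ge_zero)
  finally show ?thesis by (simp add: mult_ac)
qed

lemma apply_orbit_fun: "apply_bcontfun (orbit_fun \<xi> x) s = blinfun_apply \<xi> (conj_proj s x)"
proof -
  have "(\<lambda>s. blinfun_apply \<xi> (conj_proj s x)) \<in> bcontfun"
  proof (rule bcontfun_normI)
    show "continuous_on UNIV (\<lambda>s. blinfun_apply \<xi> (conj_proj s x))"
      by (intro continuous_intros continuous_conj_proj)
    show "norm (blinfun_apply \<xi> (conj_proj s x)) \<le> norm \<xi> * norm x * (m_const Y T * norm P)" for s
      using abs_conj_proj_le by simp
  qed
  then show ?thesis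
    by (simp add: orbit_fun_def Bcontfun_inverse)
qed

lemma bounded_bilinear_orbit_fun: "bounded_bilinear orbit_fun"
proof
  show "\<exists>K. \<forall>\<xi> x. norm (orbit_fun \<xi> x) \<le> norm \<xi> * norm x * K"
  proof (intro exI allI)
    show "norm (orbit_fun \<xi> x) \<le> norm \<xi> * norm x * (m_const Y T * norm P)" for \<xi> x
      by (rule norm_bound) (unfold apply_orbit_fun real_norm_def, rule abs_conj_proj_le)
  qed
  have "conj_proj s (r *\<^sub>R x) = r *\<^sub>R conj_proj s x" for s r x
    using conj_proj_scale[of s "of_real r" x] by (simp add: scale_of_real)
  then show "orbit_fun \<xi> (r *\<^sub>R x) = r *\<^sub>R orbit_fun \<xi> x" for \<xi> r x
    by (intro bcontfun_eqI) (simp add: apply_orbit_fun blinfun.scaleR_right)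
qed (auto intro!: bcontfun_eqI simp: apply_orbit_fun conj_proj_add blinfun.add_right
    blinfun.add_left blinfun.scaleR_left)

interpretation orbit_fun: bounded_bilinear orbit_fun
  by (rule bounded_bilinear_orbit_fun)

text \<open>On \<open>Y\<close> this is \<open>\<xi>\<close> after the inverse of \<open>T u\<close>. Writing it in coordinates extends it to the whole
  space, and shows that it depends on \<open>u\<close> continuously in norm.\<close>

definition pullback :: "('x \<Rightarrow>\<^sub>L real) \<Rightarrow> 's \<Rightarrow> ('x \<Rightarrow>\<^sub>L real)" where
  "pullback \<xi> u = (\<Sum>b\<in>B. blinfun_apply \<xi> (R u b) *\<^sub>R coord b)"

lemma apply_pullback: "y \<in> Y \<Longrightarrow> blinfun_apply (pullback \<xi> u) y = blinfun_apply \<xi> (R u y)"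
  by (simp add: pullback_def R_expansion[of y u] blinfun.sum_left blinfun.sum_right
      blinfun.scaleR_left blinfun.scaleR_right mult.commute)

lemma continuous_pullback: "continuous_on UNIV (pullback \<xi>)"
  unfolding pullback_def using B_subset
  by (intro continuous_on_sum continuous_on_scaleR continuous_on_const blinfun.continuous_on continuous_R) auto

lemma orbit_fun_mult:
  "apply_bcontfun (orbit_fun \<xi> x) (s * u) = apply_bcontfun (orbit_fun (pullback \<xi> u) (blinfun_apply (T u) x)) s"
  by (simp add: apply_orbit_fun conj_proj_mult apply_pullback conj_proj_in_Y)

lemma orbit_fun_in_C_r: "orbit_fun \<xi> x \<in> C_r"
  by (simp add: C_r_def orbit_fun_mult)

text \<open>Translating an orbit function yields an orbit function, whose two arguments vary continuously with
  \<open>u\<close>. All continuity of translations is read off from this.\<close>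

lemma rtrans_orbit_fun:
  "rtrans (orbit_fun \<xi> x) u = orbit_fun (pullback \<xi> u) (blinfun_apply (T u) x)"
  by (rule bcontfun_eqI) (simp add: apply_rtrans orbit_fun_in_C_r orbit_fun_mult)

lemma rtrans_orbit_fun_mult: "rtrans (orbit_fun \<xi> x) (s * t) =
    rtrans (orbit_fun (pullback \<xi> t) (blinfun_apply (T t) x)) s"
  by (simp add: orbit_fun_in_C_r flip: rtrans_rtrans rtrans_orbit_fun)

lemma orbit_fun_in_C_norm:
  assumes "\<And>x. continuous_on UNIV (\<lambda>s. blinfun_apply (T s) x)"
  shows "orbit_fun \<xi> x \<in> C_norm"
proof -
  have "continuous_on UNIV (\<lambda>s. rtrans (orbit_fun \<xi> x) s)" for \<xi> x
    unfolding rtrans_orbit_fun by (intro orbit_fun.continuous_on continuous_pullback assms)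
  then show ?thesis
    by (simp add: C_norm_def orbit_fun_in_C_r rtrans_orbit_fun_mult)
qed

text \<open>Expanding the pulled back functional in coordinates, a functional \<open>\<psi>\<close> on \<open>C_r\<close> takes at the translate
  by \<open>s\<close> a finite sum of the values \<open>\<psi> (orbit_fun (coord b) (T s x))\<close> with coefficients
  continuous in \<open>s\<close>. Each such value is a bounded real functional of \<open>T s x\<close>, to which weak continuity
  of \<open>T\<close> applies.\<close>

lemma orbit_fun_in_C_weak: "orbit_fun \<xi> x \<in> C_weak"
proof -
  have "continuous_map euclidean (weak_topology_on C_r) (\<lambda>s. rtrans (orbit_fun \<xi> x) s)" for \<xi> x
    unfolding weak_continuous_C_r
  proof (intro conjI allI ballI)
    show "rtrans (orbit_fun \<xi> x) s \<in> C_r" for s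
      by (intro rtrans_in_C_r orbit_fun_in_C_r)
    fix \<psi> :: "('s \<Rightarrow>\<^sub>C real) \<Rightarrow> real" assume "\<psi> \<in> dual_on C_r"
    then have add: "\<And>f g. f \<in> C_r \<Longrightarrow> g \<in> C_r \<Longrightarrow> \<psi> (f + g) = \<psi> f + \<psi> g"
      and scale: "\<And>c f. f \<in> C_r \<Longrightarrow> \<psi> (c *\<^sub>R f) = c * \<psi> f"
      and "\<exists>K. \<forall>f\<in>C_r. \<bar>\<psi> f\<bar> \<le> K * norm f"
      by (auto simp: dual_on_def linear_functional_on_def)
    then obtain K where bound: "\<And>f. f \<in> C_r \<Longrightarrow> \<bar>\<psi> f\<bar> \<le> K * norm f"
      by blast
    have zero: "\<psi> 0 = 0"
      using scale[of 0 0] Real_Vector_Spaces.subspace_0[OF subspace_C_r] by simp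
    have blin: "bounded_linear (\<lambda>x. \<psi> (orbit_fun \<eta> x))" for \<eta>
    proof -
      obtain M where M: "\<And>x. norm (orbit_fun \<eta> x) \<le> norm x * M"
        using bounded_linear.bounded[OF orbit_fun.bounded_linear_right] by blast
      show ?thesis
      proof (rule bounded_linear_intro[where K = "\<bar>K\<bar> * M"])
        fix x
        have "norm (\<psi> (orbit_fun \<eta> x)) \<le> \<bar>K\<bar> * norm (orbit_fun \<eta> x)"
          using bound[OF orbit_fun_in_C_r, of \<eta> x] by (simp add: order_trans[OF _ mult_right_mono])
        also have "\<dots> \<le> \<bar>K\<bar> * (norm x * M)"
          by (intro mult_left_mono M) simp
        finally show "norm (\<psi> (orbit_fun \<eta> x)) \<le> norm x * (\<bar>K\<bar> * M)"
          by (simp add: mult_ac)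
      qed (simp_all add: orbit_fun.add_right orbit_fun.scaleR_right add scale orbit_fun_in_C_r)
    qed
    have cont: "continuous_on UNIV (\<lambda>s. \<psi> (orbit_fun \<eta> (blinfun_apply (T s) x)))" for \<eta>
      using weakly_continuous[of "Blinfun (\<lambda>x. \<psi> (orbit_fun \<eta> x))" x]
      by (simp add: bounded_linear_Blinfun_apply[OF blin])
    have "\<psi> (rtrans (orbit_fun \<xi> x) s) =
        (\<Sum>b\<in>B. blinfun_apply \<xi> (R s b) * \<psi> (orbit_fun (coord b) (blinfun_apply (T s) x)))" for s
    proof -
      have "\<psi> (\<Sum>b\<in>B'. k b *\<^sub>R orbit_fun (coord b) z) = (\<Sum>b\<in>B'. k b * \<psi> (orbit_fun (coord b) z))"
        for B' k z
      proof (induction B' rule: infinite_finite_induct)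
        case (insert b B')
        have "(\<Sum>b\<in>B'. k b *\<^sub>R orbit_fun (coord b) z) \<in> C_r"
          by (intro Real_Vector_Spaces.subspace_sum[OF subspace_C_r]
              Real_Vector_Spaces.subspace_scale[OF subspace_C_r] orbit_fun_in_C_r)
        with insert show ?case
          by (simp add: add scale orbit_fun_in_C_r Real_Vector_Spaces.subspace_scale[OF subspace_C_r])
      qed (simp_all add: zero)
      then show ?thesis
        by (simp add: rtrans_orbit_fun pullback_def orbit_fun.sum_left orbit_fun.scaleR_left)
    qed
    moreover have "continuous_on UNIV (\<lambda>s. \<Sum>b\<in>B. blinfun_apply \<xi> (R s b) *
        \<psi> (orbit_fun (coord b) (blinfun_apply (T s) x)))"
      using B_subset
      by (intro continuous_on_sum continuous_on_mult cont blinfun.continuous_on continuous_on_const continuous_R) auto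
    ultimately show "continuous_on UNIV (\<lambda>s. \<psi> (rtrans (orbit_fun \<xi> x) s))"
      by simp
  qed
  then show ?thesis
    by (simp add: C_weak_def orbit_fun_in_C_r rtrans_orbit_fun_mult)
qed

section \<open>Averaging by an invariant mean\<close>

text \<open>The average \<open>q\<close> is defined in coordinates, but characterised by \<open>\<xi> (q x) = \<phi> (orbit_fun \<xi> x)\<close> for
  all real functionals \<open>\<xi>\<close>. Since these separate points and norm every vector, each property of \<open>q\<close>
  reduces to one of orbit functions and of the mean.\<close>

lemma ex_equivariant_projection:
  assumes F: "Real_Vector_Spaces.subspace F" "F \<subseteq> C_r" "\<And>\<xi> x. orbit_fun \<xi> x \<in> F"
    and inv: "right_invariant_mean F \<phi>"
  shows "\<exists>Q\<in>projections sc Y. commutes_with Q T \<and> norm Q \<le> m_const Y T * norm P"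
proof -
  have add: "\<phi> (f + g) = \<phi> f + \<phi> g" if "f \<in> F" "g \<in> F" for f g
    using inv that by (auto simp: right_invariant_mean_def is_mean_def linear_functional_on_def)
  have scale: "\<phi> (c *\<^sub>R f) = c * \<phi> f" if "f \<in> F" for f c
    using inv that by (auto simp: right_invariant_mean_def is_mean_def linear_functional_on_def)
  have zero: "\<phi> 0 = 0"
    using scale[OF F(3), of 0] by simp
  have invariant: "\<phi> (rtrans f s) = \<phi> f" if "f \<in> F" for f s
    using inv that by (auto simp: right_invariant_mean_def)
  have upper: "\<phi> f \<le> K" if "f \<in> F" "\<And>s. apply_bcontfun f s \<le> K" for f K
  proof -
    have "\<phi> f \<le> (SUP s. apply_bcontfun f s)"
      using inv that(1) by (auto simp: right_invariant_mean_def is_mean_def)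
    also have "\<dots> \<le> K"
      using that(2) by (intro cSUP_least) auto
    finally show ?thesis .
  qed
  have lower: "K \<le> \<phi> f" if "f \<in> F" "\<And>s. K \<le> apply_bcontfun f s" for f K
  proof -
    have "K \<le> (INF s. apply_bcontfun f s)"
      using that(2) by (intro cINF_greatest) auto
    also have "\<dots> \<le> \<phi> f"
      using inv that(1) by (auto simp: right_invariant_mean_def is_mean_def)
    finally show ?thesis .
  qed
  have phi_sum: "\<phi> (\<Sum>b\<in>B'. k b *\<^sub>R orbit_fun (coord b) x) = (\<Sum>b\<in>B'. k b * \<phi> (orbit_fun (coord b) x))"
    for B' k x
  proof (induction B' rule: infinite_finite_induct)
    case (insert b B')
    have "(\<Sum>b\<in>B'. k b *\<^sub>R orbit_fun (coord b) x) \<in> F"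
      by (intro Real_Vector_Spaces.subspace_sum[OF F(1)] Real_Vector_Spaces.subspace_scale[OF F(1)] F(3))
    with insert show ?case
      by (simp add: add scale F(3) Real_Vector_Spaces.subspace_scale[OF F(1)])
  qed (simp_all add: zero)
  define q where "q x = (\<Sum>b\<in>B. \<phi> (orbit_fun (coord b) x) *\<^sub>R b)" for x
  have q: "blinfun_apply \<xi> (q x) = \<phi> (orbit_fun \<xi> x)" for \<xi> x
  proof -
    have "orbit_fun \<xi> x = (\<Sum>b\<in>B. blinfun_apply \<xi> b *\<^sub>R orbit_fun (coord b) x)"
    proof (rule bcontfun_eqI)
      fix s
      have "blinfun_apply \<xi> (conj_proj s x)
          = blinfun_apply \<xi> (\<Sum>b\<in>B. blinfun_apply (coord b) (conj_proj s x) *\<^sub>R b)"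
        by (simp add: expansion conj_proj_in_Y)
      also have "\<dots> = blinfun_apply (\<Sum>b\<in>B. blinfun_apply \<xi> b *\<^sub>R coord b) (conj_proj s x)"
        by (simp add: blinfun.sum_left blinfun.sum_right blinfun.scaleR_left blinfun.scaleR_right mult.commute)
      also have "\<dots> = apply_bcontfun (orbit_fun (\<Sum>b\<in>B. blinfun_apply \<xi> b *\<^sub>R coord b) x) s"
        by (simp add: apply_orbit_fun)
      finally show "apply_bcontfun (orbit_fun \<xi> x) s =
          apply_bcontfun (\<Sum>b\<in>B. blinfun_apply \<xi> b *\<^sub>R orbit_fun (coord b) x) s"
        by (simp add: apply_orbit_fun orbit_fun.sum_left orbit_fun.scaleR_left)
    qed
    then show ?thesis
      by (simp add: q_def phi_sum blinfun.sum_right blinfun.scaleR_right mult.commute)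
  qed
  have q_in_Y: "q x \<in> Y" for x
    unfolding q_def using B_subset
    by (intro Real_Vector_Spaces.subspace_sum[OF real_subspace_Y]
        Real_Vector_Spaces.subspace_scale[OF real_subspace_Y]) auto
  have norm_q: "norm (q x) \<le> m_const Y T * norm P * norm x" for x
  proof -
    obtain \<xi> :: "'x \<Rightarrow>\<^sub>L real" where \<xi>: "norm \<xi> \<le> 1" "blinfun_apply \<xi> (q x) = norm (q x)"
      using ex_norming_functional by blast
    have "norm (q x) = \<phi> (orbit_fun \<xi> x)"
      by (simp add: q flip: \<xi>(2))
    also have "\<dots> \<le> 1 * norm x * (m_const Y T * norm P)"
    proof (rule upper[OF F(3)])
      fix s
      have "apply_bcontfun (orbit_fun \<xi> x) s \<le> norm \<xi> * norm x * (m_const Y T * norm P)"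
        using abs_conj_proj_le[of \<xi> s x] by (simp add: apply_orbit_fun)
      also have "\<dots> \<le> 1 * norm x * (m_const Y T * norm P)"
        using \<xi>(1) m_const_nonneg by (intro mult_right_mono) auto
      finally show "apply_bcontfun (orbit_fun \<xi> x) s \<le> 1 * norm x * (m_const Y T * norm P)" .
    qed
    finally show ?thesis by (simp add: mult_ac)
  qed
  have "bounded_linear q"
  proof (rule bounded_linear_intro[where K = "m_const Y T * norm P"])
    show "q (x + y) = q x + q y" for x y
      by (rule eq_if_functionals_agree) (simp add: q blinfun.add_right orbit_fun.add_right add F(3))
    show "q (r *\<^sub>R x) = r *\<^sub>R q x" for r x
      by (rule eq_if_functionals_agree) (simp add: q blinfun.scaleR_right orbit_fun.scaleR_right scale F(3))
    show "norm (q x) \<le> norm x * (m_const Y T * norm P)" for x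
      using norm_q[of x] by (simp add: mult_ac)
  qed
  then obtain Q where Q: "blinfun_apply Q = q"
    by (metis bounded_linear_Blinfun_apply)
  have q_scale: "q (sc c x) = sc c (q x)" for c x
  proof (rule eq_if_functionals_agree)
    fix \<xi> :: "'x \<Rightarrow>\<^sub>L real"
    define \<eta> where "\<eta> = \<xi> o\<^sub>L Blinfun (sc c)"
    have \<eta>: "blinfun_apply \<eta> z = blinfun_apply \<xi> (sc c z)" for z
      by (simp add: \<eta>_def bounded_linear_Blinfun_apply[OF bounded_linear_scale_right])
    have "orbit_fun \<xi> (sc c x) = orbit_fun \<eta> x"
      by (rule bcontfun_eqI) (simp add: apply_orbit_fun conj_proj_scale \<eta>)
    then show "blinfun_apply \<xi> (q (sc c x)) = blinfun_apply \<xi> (sc c (q x))"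
      by (simp add: q flip: \<eta>)
  qed
  have q_fix: "q y = y" if "y \<in> Y" for y
  proof (rule eq_if_functionals_agree)
    fix \<xi> :: "'x \<Rightarrow>\<^sub>L real"
    have "apply_bcontfun (orbit_fun \<xi> y) s = blinfun_apply \<xi> y" for s
      by (simp add: apply_orbit_fun conj_proj_fix that)
    then show "blinfun_apply \<xi> (q y) = blinfun_apply \<xi> y"
      unfolding q by (intro antisym upper lower F(3)) auto
  qed
  have q_commute: "q (blinfun_apply (T u) x) = blinfun_apply (T u) (q x)" for u x
  proof (rule eq_if_functionals_agree)
    fix \<xi> :: "'x \<Rightarrow>\<^sub>L real"
    \<comment> \<open>The factor \<open>T u\<close> in the functional cancels the inverse of \<open>T u\<close> produced by the translation.\<close>
    have "rtrans (orbit_fun (\<xi> o\<^sub>L T u) x) u = orbit_fun \<xi> (blinfun_apply (T u) x)"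
      by (rule bcontfun_eqI)
        (simp add: apply_rtrans orbit_fun_in_C_r apply_orbit_fun conj_proj_mult T_R conj_proj_in_Y)
    then have "\<phi> (orbit_fun \<xi> (blinfun_apply (T u) x)) = \<phi> (orbit_fun (\<xi> o\<^sub>L T u) x)"
      using invariant[OF F(3)] by metis
    then show "blinfun_apply \<xi> (q (blinfun_apply (T u) x)) = blinfun_apply \<xi> (blinfun_apply (T u) (q x))"
      by (simp flip: q)
  qed
  show ?thesis
  proof (intro bexI conjI)
    show "Q \<in> projections sc Y"
      using q_scale q_in_Y q_fix by (auto simp: projections_def bounded_operators_def Q)
    show "commutes_with Q T"
      by (auto simp: commutes_with_def Q q_commute intro!: blinfun_eqI)
    show "norm Q \<le> m_const Y T * norm P"
      using norm_q m_const_nonneg by (intro norm_blinfun_bound) (simp_all add: Q)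
  qed
qed

end

section \<open>Minimal projections\<close>

lemma compact_pointwise:
  fixes S :: "'a \<Rightarrow> 'b::topological_space set"
  assumes "\<And>x. compact (S x)"
  shows "compact {p. \<forall>x. p x \<in> S x}"
proof -
  have "compactin (product_topology (\<lambda>_. euclidean) UNIV) (PiE UNIV S)"
    using assms by (simp add: compactin_PiE)
  moreover have "PiE UNIV S = {p. \<forall>x. p x \<in> S x}"
    by auto
  ultimately show ?thesis
    by (simp add: euclidean_product_topology flip: compactin_euclidean_iff)
qed

lemma compact_finite_dim_cball:
  fixes Y :: "'a::banach set"
  assumes "finite_dim_subspace scaleR Y"
  shows "compact (Y \<inter> cball 0 r)"
proof -
  obtain B and coord :: "'a \<Rightarrow> 'a \<Rightarrow>\<^sub>L real" where B: "finite B"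
    and Y: "\<And>y. y \<in> Y \<longleftrightarrow> (\<Sum>b\<in>B. blinfun_apply (coord b) y *\<^sub>R b) = y"
    using finite_dim_coordinates[OF assms] by blast
  define box where "box = {c :: 'a \<Rightarrow> real. \<forall>b. c b \<in> {- (norm (coord b) * r)..norm (coord b) * r}}"
  define comb where "comb c = (\<Sum>b\<in>B. c b *\<^sub>R b)" for c :: "'a \<Rightarrow> real"
  have "compact (comb ` box)"
  proof (rule compact_continuous_image)
    show "continuous_on box comb"
      unfolding comb_def
      by (intro continuous_on_sum continuous_on_scaleR continuous_on_const
          continuous_on_subset[OF continuous_on_product_coordinates] subset_UNIV)
    show "compact box"
      unfolding box_def by (rule compact_pointwise) simp
  qed
  moreover have "Y \<inter> cball 0 r \<subseteq> comb ` box"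
  proof
    fix y assume y: "y \<in> Y \<inter> cball 0 r"
    have "(\<lambda>b. blinfun_apply (coord b) y) \<in> box"
    proof -
      have "\<bar>blinfun_apply (coord b) y\<bar> \<le> norm (coord b) * r" for b
        using norm_blinfun[of "coord b" y] y mult_left_mono[of "norm y" r "norm (coord b)"] by simp
      then show ?thesis by (simp add: box_def abs_le_iff minus_le_iff)
    qed
    moreover have "y = comb (\<lambda>b. blinfun_apply (coord b) y)"
      using y Y by (simp add: comb_def)
    ultimately show "y \<in> comb ` box" by blast
  qed
  moreover have "closed Y"
  proof -
    have "closed {y. (\<Sum>b\<in>B. blinfun_apply (coord b) y *\<^sub>R b) = y}"
      by (intro closed_Collect_eq continuous_intros)
    moreover have "Y = {y. (\<Sum>b\<in>B. blinfun_apply (coord b) y *\<^sub>R b) = y}"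
      using Y by blast
    ultimately show ?thesis by metis
  qed
  ultimately show ?thesis
    by (metis closed_Int closed_cball compact_Int_closed inf.absorb_iff2)
qed

context banach_space_over
begin

text \<open>In the topology of pointwise convergence, the maps that satisfy the defining equations of a
  commuting projection and the bound \<open>norm (p x) \<le> r * norm x\<close> form a compact set, by Tychonoff's
  theorem and compactness of balls in \<open>Y\<close>. These sets are nested and non-empty for \<open>r\<close> above the infimum
  \<open>\<rho>\<close> of the norms, and any common point has norm \<open>\<rho>\<close>.\<close>

lemma ex_minimal_projection:
  assumes Y: "finite_dim_subspace sc Y"
    and Q: "Q \<in> projections sc Y" "commutes_with Q T"
  shows "\<exists>P. minimal_projection sc Y T P"
proof -
  define S where "S = {Q \<in> projections sc Y. commutes_with Q T}"
  define \<rho> where "\<rho> = (INF Q\<in>S. norm Q)"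
  have S: "Q \<in> S" using Q by (simp add: S_def)
  have bdd: "bdd_below (norm ` S)"
    by (rule bdd_belowI[of _ 0]) auto
  define bounded where "bounded r = {p :: 'x \<Rightarrow> 'x. \<forall>x. norm (p x) \<le> r * norm x}" for r :: real
  define eqs where "eqs = {p :: 'x \<Rightarrow> 'x. (\<forall>x y. p (x + y) = p x + p y) \<and> (\<forall>c x. p (sc c x) = sc c (p x)) \<and>
      (\<forall>y\<in>Y. p y = y) \<and> (\<forall>s x. p (blinfun_apply (T s) x) = blinfun_apply (T s) (p x))}"
  define K where "K = {p. \<forall>x. p x \<in> Y \<inter> cball 0 ((\<rho> + 1) * norm x)} \<inter> eqs"
  have in_eqs: "blinfun_apply R \<in> eqs" "blinfun_apply R x \<in> Y" if "R \<in> S" for R x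
  proof -
    have commute: "blinfun_apply R (blinfun_apply (T s) x) = blinfun_apply (T s) (blinfun_apply R x)" for s x
    proof -
      have "R o\<^sub>L T s = T s o\<^sub>L R"
        using that by (simp add: S_def commutes_with_def)
      from arg_cong[OF this, of "\<lambda>A. blinfun_apply A x"] show ?thesis
        by simp
    qed
    have scale: "blinfun_apply R (sc c x) = sc c (blinfun_apply R x)" for c x
      using that by (simp add: S_def projections_def bounded_operators_def)
    have fix_Y: "blinfun_apply R y = y" if "y \<in> Y" for y
      using \<open>R \<in> S\<close> that by (simp add: S_def projections_def)
    show "blinfun_apply R \<in> eqs"
      unfolding eqs_def
      by (intro CollectI conjI allI ballI) (rule blinfun.add_right scale fix_Y commute | assumption)+
    show "blinfun_apply R x \<in> Y"
      using that by (auto simp: S_def projections_def)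
  qed
  have coord: "continuous_on UNIV (\<lambda>p :: 'x \<Rightarrow> 'x. p x)" for x
    by (rule continuous_on_product_coordinates)
  have closed_bounded: "closed (bounded r)" for r
    unfolding bounded_def
    by (intro closed_Collect_all closed_Collect_le continuous_on_norm coord continuous_on_const)
  have "closed eqs"
    unfolding eqs_def Ball_def
    by (intro closed_Collect_conj closed_Collect_all closed_Collect_imp closed_Collect_eq open_Collect_const
        coord continuous_on_add continuous_on_const bounded_linear.continuous_on[OF bounded_linear_scale_right]
        bounded_linear.continuous_on[OF blinfun.bounded_linear_right])
  then have compact_K: "compact K"
    unfolding K_def
    by (intro compact_Int_closed compact_pointwise compact_finite_dim_cball finite_dim_subspace_real[OF Y])
  have fip: "K \<inter> \<Inter> (bounded ` I) \<noteq> {}" if "finite I" "I \<subseteq> {\<rho><..}" for I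
  proof -
    define r where "r = Min (insert (\<rho> + 1) I)"
    have r: "r \<le> \<rho> + 1" "\<And>i. i \<in> I \<Longrightarrow> r \<le> i" and "\<rho> < r"
      using that by (auto simp: r_def)
    then obtain R where R: "R \<in> S" "norm R < r"
      using S bdd cINF_less_iff[of S norm r] unfolding \<rho>_def by blast
    have le: "norm (blinfun_apply R x) \<le> t * norm x" if "r \<le> t" for t x
    proof -
      have "norm (blinfun_apply R x) \<le> norm R * norm x" by (rule norm_blinfun)
      also have "\<dots> \<le> t * norm x" using R(2) that by (intro mult_right_mono) auto
      finally show ?thesis .
    qed
    then have "blinfun_apply R \<in> K \<inter> \<Inter> (bounded ` I)"
      using in_eqs[OF R(1)] r by (auto simp: K_def bounded_def)
    then show ?thesis by blast
  qed
  have "K \<inter> \<Inter> (bounded ` {\<rho><..}) \<noteq> {}"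
    by (rule compact_imp_fip_image[OF compact_K closed_bounded fip])
  then obtain p where p: "p \<in> K" "\<And>r. \<rho> < r \<Longrightarrow> p \<in> bounded r"
    by auto
  have norm_p: "norm (p x) \<le> \<rho> * norm x" for x
  proof (rule field_le_epsilon)
    fix e :: real assume "0 < e"
    \<comment> \<open>Dividing by \<open>norm x + 1\<close> covers \<open>x = 0\<close> as well.\<close>
    then have "norm (p x) \<le> (\<rho> + e / (norm x + 1)) * norm x"
      using p(2)[of "\<rho> + e / (norm x + 1)"] by (auto simp: bounded_def add_nonneg_pos)
    also have "\<dots> = \<rho> * norm x + e * (norm x / (norm x + 1))"
      by (simp add: distrib_right)
    also have "\<dots> \<le> \<rho> * norm x + e"
      using \<open>0 < e\<close> by (intro add_left_mono mult_left_le) (simp_all add: divide_le_eq_1 add_nonneg_pos)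
    finally show "norm (p x) \<le> \<rho> * norm x + e" .
  qed
  have "bounded_linear p"
  proof (rule bounded_linear_intro[where K = \<rho>])
    show "p (r *\<^sub>R x) = r *\<^sub>R p x" for r x
      using p(1) by (auto simp: K_def eqs_def simp flip: scale_of_real)
  qed (use p(1) norm_p in \<open>auto simp: K_def eqs_def mult.commute\<close>)
  then obtain P where P: "blinfun_apply P = p"
    by (metis bounded_linear_Blinfun_apply)
  have "0 \<le> \<rho>"
    unfolding \<rho>_def using S by (intro cINF_greatest) auto
  then have "norm P \<le> \<rho>"
    using norm_p by (intro norm_blinfun_bound) (simp_all add: P)
  moreover have "\<rho> \<le> norm R" if "R \<in> S" for R
    unfolding \<rho>_def using bdd that by (rule cINF_lower)
  ultimately have "norm P \<le> norm R" if "R \<in> projections sc Y" "commutes_with R T" for R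
    using that by (force simp: S_def)
  moreover have "P \<in> projections sc Y" "commutes_with P T"
    using p(1) by (auto simp: K_def eqs_def projections_def bounded_operators_def commutes_with_def P
        intro!: blinfun_eqI)
  ultimately show ?thesis
    unfolding minimal_projection_def by blast
qed

text \<open>The weak operator topology is defined by functionals over the scalar field; every real functional
  is the component along \<open>1\<close> of one of them.\<close>

lemma WOT_continuous_imp_weakly_continuous:
  fixes T :: "'s::topological_space \<Rightarrow> ('x \<Rightarrow>\<^sub>L 'x)" and h :: "'x \<Rightarrow>\<^sub>L real"
  assumes "continuous_map euclidean (WOT sc) T" and T: "\<And>s. T s \<in> bounded_operators sc"
  shows "continuous_on UNIV (\<lambda>s. blinfun_apply h (blinfun_apply (T s) x))"
proof -
  obtain f where f: "f \<in> dual_space sc"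
      "\<And>x c. inner (blinfun_apply f x) c = blinfun_apply h (sc (adjoint_scalar c) x)"
    using ex_dual_of_real_functional[of h] by blast
  have h: "blinfun_apply h z = inner (blinfun_apply f z) 1" for z
    by (simp add: f(2) adjoint_scalar_1)
  have "open ((\<lambda>s. blinfun_apply f (blinfun_apply (T s) x)) -` U)" if "open U" for U
  proof -
    have "open (T -` V)" if "V \<in> {{A \<in> bounded_operators sc. blinfun_apply f (blinfun_apply A x) \<in> U} | f x U.
        f \<in> dual_space sc \<and> open U}" for V
      using assms(1) that unfolding WOT_def continuous_on_generated_topo_iff
      by (simp only: topspace_euclidean Int_UNIV_right open_openin)
    then have "open (T -` {A \<in> bounded_operators sc. blinfun_apply f (blinfun_apply A x) \<in> U})"
      using f(1) that by blast
    then show ?thesis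
      using T by (simp add: vimage_def)
  qed
  then have "continuous_on UNIV (\<lambda>s. blinfun_apply f (blinfun_apply (T s) x))"
    by (simp add: continuous_on_open_vimage)
  then show ?thesis
    unfolding h by (intro continuous_on_inner continuous_on_const)
qed

end

lemma SOT_continuous_imp_continuous:
  fixes T :: "'s::topological_space \<Rightarrow> ('x::banach \<Rightarrow>\<^sub>L 'x)"
  assumes "continuous_map euclidean (SOT sc) T"
  shows "continuous_on UNIV (\<lambda>s. blinfun_apply (T s) x)"
  using assms continuous_map_compose[OF _ strong_operator_topology_continuous_evaluation[of x], of euclidean T]
  by (simp add: SOT_def continuous_map_in_subtopology o_def)

section \<open>The minimal projection and its norm\<close>

text \<open>Both versions of the theorem are instances of this, with \<open>F\<close> the function space that carries the mean.\<close>

lemma (in banach_space_over) minimal_projection_of_mean: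
  fixes T :: "'s::{semigroup_mult, topological_space} \<Rightarrow> ('x \<Rightarrow>\<^sub>L 'x)"
  assumes operators: "\<And>s. T s \<in> bounded_operators sc"
    and hom: "\<And>s t. T (s * t) = T s o\<^sub>L T t"
    and fin_dim: "finite_dim_subspace sc Y"
    and image_Y: "\<And>s. blinfun_apply (T s) ` Y = Y"
    and bdd: "bdd_above (range (m_term Y T))"
    and weakly_continuous:
      "\<And>(h :: 'x \<Rightarrow>\<^sub>L real) x. continuous_on UNIV (\<lambda>s. blinfun_apply h (blinfun_apply (T s) x))"
    and F: "Real_Vector_Spaces.subspace F" "F \<subseteq> C_r"
      "\<And>P B coord \<xi> x. averaging sc T Y P B coord \<Longrightarrow> averaging.orbit_fun T Y P \<xi> x \<in> F"
    and inv: "right_invariant_mean F \<phi>"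
  shows "\<exists>P. minimal_projection sc Y T P \<and> norm P \<le> m_const Y T * projection_constant sc Y"
proof -
  obtain B and coord :: "'x \<Rightarrow> 'x \<Rightarrow>\<^sub>L real" where B: "B \<subseteq> Y"
    and expansion: "\<And>y. y \<in> Y \<Longrightarrow> (\<Sum>b\<in>B. blinfun_apply (coord b) y *\<^sub>R b) = y"
    using finite_dim_coordinates[OF finite_dim_subspace_real[OF fin_dim]] by blast
  have averaging: "averaging sc T Y P B coord" if "P \<in> projections sc Y" for P
    by unfold_locales (fact operators hom fin_dim image_Y bdd weakly_continuous that B expansion)+
  have equivariant: "\<exists>Q\<in>projections sc Y. commutes_with Q T \<and> norm Q \<le> m_const Y T * norm P"
    if "P \<in> projections sc Y" for P
    using averaging.ex_equivariant_projection[OF averaging[OF that] F(1,2) F(3)[OF averaging[OF that]] inv] .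
  obtain P1 where P1: "P1 \<in> projections sc Y"
    using ex_projection[OF fin_dim] by blast
  then obtain P0 where P0: "minimal_projection sc Y T P0"
    using equivariant ex_minimal_projection[OF fin_dim] by blast
  have le: "norm P0 \<le> m_const Y T * norm P" if "P \<in> projections sc Y" for P
    using equivariant[OF that] P0 unfolding minimal_projection_def by (meson order_trans)
  have "norm P0 \<le> m_const Y T * projection_constant sc Y"
  \<comment> \<open>The constant is \<open>0\<close> when \<open>Y\<close> is trivial, so that division by it needs a case distinction.\<close>
  proof (cases "m_const Y T = 0")
    case True
    then show ?thesis using le[OF P1] by simp
  next
    case False
    then have m: "0 < m_const Y T"
      using averaging.m_const_nonneg[OF averaging[OF P1]] by simp
    have "norm P0 / m_const Y T \<le> projection_constant sc Y"
      unfolding projection_constant_def using P1 le m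
      by (intro cINF_greatest) (auto simp: divide_le_eq mult.commute)
    then show ?thesis
      using m by (simp add: divide_le_eq mult.commute)
  qed
  with P0 show ?thesis by blast
qed

theorem theorem4p7:
  fixes sc :: "'k::{real_normed_field, euclidean_space} \<Rightarrow> 'x::banach \<Rightarrow> 'x"
    and T :: "'s::{semigroup_mult, topological_space} \<Rightarrow> ('x \<Rightarrow>\<^sub>L 'x)"
    and Y :: "'x set"
  assumes banach: "banach_space_over sc"
    and operators: "\<And>s. T s \<in> bounded_operators sc"
    and hom: "\<And>s t. T (s * t) = T s o\<^sub>L T t"
    and fin_dim: "finite_dim_subspace sc Y"
    and fp1: "\<And>s. blinfun_apply (T s) ` Y = Y"
    and p4': "bdd_above (range (m_term Y T))"
  shows "(strongly_right_amenable TYPE('s) \<and> continuous_map euclidean (WOT sc) T \<longrightarrow>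
            (\<exists>P. minimal_projection sc Y T P \<and>
                 norm P \<le> m_const Y T * projection_constant sc Y)) \<and>
         (weakly_right_amenable TYPE('s) \<and> continuous_map euclidean (SOT sc) T \<longrightarrow>
            (\<exists>P. minimal_projection sc Y T P \<and>
                 norm P \<le> m_const Y T * projection_constant sc Y))"
proof -
  interpret banach_space_over sc by (rule banach)
  have strong: "\<exists>P. minimal_projection sc Y T P \<and> norm P \<le> m_const Y T * projection_constant sc Y"
    if "strongly_right_amenable TYPE('s)" "continuous_map euclidean (WOT sc) T"
  proof -
    obtain \<phi> where mean: "right_invariant_mean (C_weak :: ('s \<Rightarrow>\<^sub>C real) set) \<phi>"
      using \<open>strongly_right_amenable TYPE('s)\<close> by (auto simp: strongly_right_amenable_def)
    have "C_weak \<subseteq> (C_r :: ('s \<Rightarrow>\<^sub>C real) set)"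
      by (auto simp: C_weak_def)
    from minimal_projection_of_mean[OF operators hom fin_dim fp1 p4'
        WOT_continuous_imp_weakly_continuous[OF that(2) operators] subspace_C_weak this
        averaging.orbit_fun_in_C_weak mean]
    show ?thesis .
  qed
  have weak: "\<exists>P. minimal_projection sc Y T P \<and> norm P \<le> m_const Y T * projection_constant sc Y"
    if "weakly_right_amenable TYPE('s)" "continuous_map euclidean (SOT sc) T"
  proof -
    obtain \<phi> where mean: "right_invariant_mean (C_norm :: ('s \<Rightarrow>\<^sub>C real) set) \<phi>"
      using \<open>weakly_right_amenable TYPE('s)\<close> by (auto simp: weakly_right_amenable_def)
    have cont: "continuous_on UNIV (\<lambda>s. blinfun_apply (T s) x)" for x
      using SOT_continuous_imp_continuous[OF that(2)] .
    have weakly_cont: "continuous_on UNIV (\<lambda>s. blinfun_apply h (blinfun_apply (T s) x))"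
      for h :: "'x \<Rightarrow>\<^sub>L real" and x
      by (intro blinfun.continuous_on continuous_on_const cont)
    have "C_norm \<subseteq> (C_r :: ('s \<Rightarrow>\<^sub>C real) set)"
      by (auto simp: C_norm_def)
    from minimal_projection_of_mean[OF operators hom fin_dim fp1 p4' weakly_cont subspace_C_norm this
        averaging.orbit_fun_in_C_norm[OF _ cont] mean]
    show ?thesis .
  qed
  from strong weak show ?thesis by blast
qed

end
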